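(* Let $\mathfrak g=\mathfrak b\oplus V\oplus\mathfrak z$ be the Lie algebra of a rotational datum. Let $r\in\Lambda^2\mathfrak g$ and let $p=\operatorname{pr}_{\mathfrak b\wedge V}(r)=\sum_{\ell=1}^mp_\ell$, $p_\ell\in\mathfrak b\wedge P_\ell$, be its $\mathfrak b\wedge V$ component. Assume $p\in\mathcal R^{(1)}$. If $[r,r]=0$, then $p\in\mathcal R^0$; equivalently, for every nonzero block, every factorisation $p_\ell=h_\ell\wedge u_\ell$ ($h_\ell\in\mathfrak b$, $u_\ell\in P_\ell$) satisfies $\lambda_\ell(h_\ell)=0$. Consequently: (a) if $[r,r]=0$ and $p\in\mathcal R^+$, then $p=0$; (b) for every $H=(h_1,\dots,h_m)\in\mathfrak b^m$ with $\lambda_\ell(h_\ell)>0$ for all $\ell$, the only $r\in S_H=\bigoplus_\ell h_\ell\wedge P_\ell$ with $[r,r]=0$ is $r=0$; (c) arbitrary components in $\Lambda^2\mathfrak b$, $\Lambda^2V$ and $\mathfrak z\wedge\mathfrak g$ cannot cancel a non-null rank-one block: if $p\in\mathcal R^{(1)}$ has a nonzero block $p_\ell=h_\ell\wedge u_\ell$ with $\lambda_\ell(h_\ell)\ne0$, then $[s+p+q+c,\,s+p+q+c]\neq0$ for all $s\in\Lambda^2\mathfrak b$, $q\in\Lambda^2V$, $c\in\mathfrak z\wedge\mathfrak g$; (d) if $\dim\mathfrak b=1$, every $r\in\Lambda^2\mathfrak g$ with $[r,r]=0$ has zero $\mathfrak b\wedge V$ component, for all choices of the nonzero weights $\lamb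da_1,\dots,\lambda_m$.
   Context: Rotational datum: a finite-dimensional real abelian Lie algebra $\mathfrak b$; an orthogonal direct sum $V=\bigoplus_{\ell=1}^m P_\ell$ of oriented Euclidean two-planes; nonzero weights $\lambda_\ell\in\mathfrak b^*$. $J_\ell$ is the positive quarter-turn on $P_\ell$ and $\rho(b)|_{P_\ell}=\lambda_\ell(b)J_\ell$. Put $\mathfrak z=\mathfrak b^*$ and $\beta\colon\Lambda^2V\to\mathfrak z$, $\beta(u,v)(b)=\langle\rho(b)u,v\rangle$. The Lie algebra $\mathfrak g=\mathfrak b\oplus V\oplus\mathfrak z$ has bracket $[b,b']=0$, $[b,u]=\rho(b)u$, $[u,v]=\beta(u,v)$, $[\mathfrak z,\mathfrak g]=0$. The Schouten bracket on $\Lambda^2\mathfrak g$ is the symmetric bilinear map to $\Lambda^3\mathfrak g$ with $[x\wedge y,z\wedge w]=[x,z]\wedge y\wedge w-[x,w]\wedge y\wedge z-[y,z]\wedge x\wedge w+[y,w]\wedge x\wedge z$. The projection $\operatorname{pr}_{\mathfrak b\wedge V}$ is with respect to $\Lambda^2\mathfrak g=\Lambda^2\mathfrak b\oplus(\mathfrak b\wedge V)\oplus\Lambda^2V\oplus(\mathfrak z\wedge\mathfrak g)$, and $\mathfrak b\wedge V=\bigoplus_\ell\mathfrak b\wedge P_\ell$ with $\mathfrak b\wedge P_\ell\cong\mathfrak b\otimes P_\ell$. For $p\in\mathfrak b\wedge V$ with blocks $p_\ell$: $\mathcal R^{(1)}=\{p:\operatorname{rank}(p_\ell)\le1\ \forall\ell\}$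 (tensor rank). A nonzero block of rank one is $p_\ell=h_\ell\wedge u_\ell$, and the line $\mathbb Rh_\ell$ depends only on $p_\ell$. $\mathcal R^0=\{p\in\mathcal R^{(1)}:\mathbb Rh_\ell\subset\ker\lambda_\ell\ \forall p_\ell\ne0\}$ and $\mathcal R^+=\{p\in\mathcal R^{(1)}:\mathbb Rh_\ell\not\subset\ker\lambda_\ell\ \forall p_\ell\neq0\}$. *)

theory Defs
  imports "HOL-Analysis.Analysis"
begin

text \<open>
  Elements of the exterior square are formal sums \<open>x\<^sub>1 \<and> y\<^sub>1 + \<dots> + x\<^sub>n \<and> y\<^sub>n\<close>, represented
  by lists of pairs, modulo the congruence generated by biadditivity, homogeneity
  and alternation.  Scalars are absorbed into the first entry.
\<close>

inductive ext2_rel :: "('a::real_vector \<times> 'a) list \<Rightarrow> ('a \<times> 'a) list \<Rightarrow> bool" where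
  ext2_refl: "ext2_rel xs xs"
| ext2_sym: "ext2_rel xs ys \<Longrightarrow> ext2_rel ys xs"
| ext2_trans: "ext2_rel xs ys \<Longrightarrow> ext2_rel ys zs \<Longrightarrow> ext2_rel xs zs"
| ext2_append: "ext2_rel xs xs' \<Longrightarrow> ext2_rel ys ys' \<Longrightarrow> ext2_rel (xs @ ys) (xs' @ ys')"
| ext2_comm: "ext2_rel (xs @ ys) (ys @ xs)"
| ext2_add1: "ext2_rel [(x + x', y)] [(x, y), (x', y)]"
| ext2_add2: "ext2_rel [(x, y + y')] [(x, y), (x, y')]"
| ext2_scale: "ext2_rel [(c *\<^sub>R x, y)] [(x, c *\<^sub>R y)]"
| ext2_alt: "ext2_rel [(x, x)] []"

inductive ext3_rel :: "('a::real_vector \<times> 'a \<times> 'a) list \<Rightarrow> ('a \<times> 'a \<times> 'a) list \<Rightarrow> bool" where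
  ext3_refl: "ext3_rel xs xs"
| ext3_sym: "ext3_rel xs ys \<Longrightarrow> ext3_rel ys xs"
| ext3_trans: "ext3_rel xs ys \<Longrightarrow> ext3_rel ys zs \<Longrightarrow> ext3_rel xs zs"
| ext3_append: "ext3_rel xs xs' \<Longrightarrow> ext3_rel ys ys' \<Longrightarrow> ext3_rel (xs @ ys) (xs' @ ys')"
| ext3_comm: "ext3_rel (xs @ ys) (ys @ xs)"
| ext3_add1: "ext3_rel [(x + x', y, z)] [(x, y, z), (x', y, z)]"
| ext3_add2: "ext3_rel [(x, y + y', z)] [(x, y, z), (x, y', z)]"
| ext3_add3: "ext3_rel [(x, y, z + z')] [(x, y, z), (x, y, z')]"
| ext3_scale12: "ext3_rel [(c *\<^sub>R x, y, z)] [(x, c *\<^sub>R y, z)]"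
| ext3_scale23: "ext3_rel [(x, c *\<^sub>R y, z)] [(x, y, c *\<^sub>R z)]"
| ext3_alt12: "ext3_rel [(x, x, z)] []"
| ext3_alt23: "ext3_rel [(x, y, y)] []"
| ext3_alt13: "ext3_rel [(x, y, x)] []"

lemma equivp_ext2_rel: "equivp ext2_rel"
  by (rule equivpI) (auto simp: reflp_def symp_def transp_def
      intro: ext2_refl ext2_sym ext2_trans)

lemma equivp_ext3_rel: "equivp ext3_rel"
  by (rule equivpI) (auto simp: reflp_def symp_def transp_def
      intro: ext3_refl ext3_sym ext3_trans)

quotient_type (overloaded) 'a ext2 = "('a::real_vector \<times> 'a) list" / ext2_rel
  morphisms rep_ext2 abs_ext2
  by (rule equivp_ext2_rel)

quotient_type (overloaded) 'a ext3 = "('a::real_vector \<times> 'a \<times> 'a) list" / ext3_rel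
  morphisms rep_ext3 abs_ext3
  by (rule equivp_ext3_rel)

lemma ext2_rel_zero: "ext2_rel [(0::'a::real_vector, y)] []"
proof -
  have "ext2_rel [(y, y)] ([(0, y)] @ [(y, y)])"
    using ext2_add1[of 0 y y] by simp
  moreover have "ext2_rel ([(0, y)] @ [(y, y)]) ([(0, y)] @ [])"
    by (intro ext2_append ext2_refl ext2_alt)
  ultimately show ?thesis
    by (metis append_Nil2 ext2_alt ext2_sym ext2_trans)
qed

lemma ext2_rel_alt_scale: "ext2_rel [(c *\<^sub>R x, x)] ([]::('a::real_vector \<times> 'a) list)"
proof -
  let ?y = "(c/2) *\<^sub>R x"
  have "ext2_rel [(?y + x, ?y + x)] ([(?y, ?y + x)] @ [(x, ?y + x)])"
    using ext2_add1[of ?y x "?y + x"] by simp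
  moreover have "ext2_rel ([(?y, ?y + x)] @ [(x, ?y + x)])
      (([(?y, ?y)] @ [(?y, x)]) @ ([(x, ?y)] @ [(x, x)]))"
    using ext2_append[OF ext2_add2[of ?y ?y x] ext2_add2[of x ?y x]] by simp
  moreover have "ext2_rel (([(?y, ?y)] @ [(?y, x)]) @ ([(x, ?y)] @ [(x, x)]))
      (([] @ [(?y, x)]) @ ([(?y, x)] @ []))"
    by (intro ext2_append ext2_refl ext2_alt ext2_sym[OF ext2_scale])
  ultimately have 1: "ext2_rel [] [(?y, x), (?y, x)]"
    using ext2_sym[OF ext2_alt] by simp (blast intro: ext2_trans)
  have "ext2_rel [(c *\<^sub>R x, x)] [(?y, x), (?y, x)]"
    using ext2_add1[of ?y ?y x] by (simp flip: scaleR_add_left)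
  with 1 show ?thesis by (meson ext2_sym ext2_trans)
qed

lemma ext2_rel_scale_map:
  "ext2_rel xs ys \<Longrightarrow>
    ext2_rel (map (\<lambda>(x, y). (c *\<^sub>R x, y)) xs) (map (\<lambda>(x, y). (c *\<^sub>R x, y)) ys)"
proof (induction rule: ext2_rel.induct)
  case (ext2_sym xs ys)
  show ?case by (rule ext2_rel.ext2_sym) (rule ext2_sym.IH)
next
  case (ext2_trans xs ys zs)
  show ?case by (rule ext2_rel.ext2_trans) (rule ext2_trans.IH)+
next
  case (ext2_scale a x y)
  show ?case using ext2_rel.ext2_scale[of a "c *\<^sub>R x" y] by (simp add: mult.commute)
qed (auto simp: scaleR_add_right intro: ext2_refl ext2_append ext2_comm
    ext2_add1 ext2_add2 ext2_rel_alt_scale)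

lemma ext3_rel_zero: "ext3_rel [(0::'a::real_vector, y, z)] []"
proof -
  have "ext3_rel [(y, y, z)] ([(0, y, z)] @ [(y, y, z)])"
    using ext3_add1[of 0 y y z] by simp
  moreover have "ext3_rel ([(0, y, z)] @ [(y, y, z)]) ([(0, y, z)] @ [])"
    by (intro ext3_append ext3_refl ext3_alt12)
  ultimately show ?thesis
    by (metis append_Nil2 ext3_alt12 ext3_sym ext3_trans)
qed

lemma ext3_rel_alt12_scale: "ext3_rel [(c *\<^sub>R x, x, z)] ([]::('a::real_vector \<times> 'a \<times> 'a) list)"
proof -
  let ?y = "(c/2) *\<^sub>R x"
  have "ext3_rel [(?y + x, ?y + x, z)] ([(?y, ?y + x, z)] @ [(x, ?y + x, z)])"
    using ext3_add1[of ?y x "?y + x"] by simp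
  moreover have "ext3_rel ([(?y, ?y + x, z)] @ [(x, ?y + x, z)])
      (([(?y, ?y, z)] @ [(?y, x, z)]) @ ([(x, ?y, z)] @ [(x, x, z)]))"
    using ext3_append[OF ext3_add2[of ?y ?y x] ext3_add2[of x ?y x]] by simp
  moreover have "ext3_rel (([(?y, ?y, z)] @ [(?y, x, z)]) @ ([(x, ?y, z)] @ [(x, x, z)]))
      (([] @ [(?y, x, z)]) @ ([(?y, x, z)] @ []))"
    by (intro ext3_append ext3_refl ext3_alt12 ext3_sym[OF ext3_scale12])
  ultimately have 1: "ext3_rel [] [(?y, x, z), (?y, x, z)]"
    using ext3_sym[OF ext3_alt12] by simp (blast intro: ext3_trans)
  have "ext3_rel [(c *\<^sub>R x, x, z)] [(?y, x, z), (?y, x, z)]"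
    using ext3_add1[of ?y ?y x] by (simp flip: scaleR_add_left)
  with 1 show ?thesis by (meson ext3_sym ext3_trans)
qed

lemma ext3_rel_alt13_scale: "ext3_rel [(c *\<^sub>R x, z, x)] ([]::('a::real_vector \<times> 'a \<times> 'a) list)"
proof -
  let ?y = "(c/2) *\<^sub>R x"
  have s: "ext3_rel [(x, z, ?y)] [(?y, z, x)]"
    by (meson ext3_scale12 ext3_scale23 ext3_sym ext3_trans)
  have "ext3_rel [(?y + x, z, ?y + x)] ([(?y, z, ?y + x)] @ [(x, z, ?y + x)])"
    using ext3_add1[of ?y x z "?y + x"] by simp
  moreover have "ext3_rel ([(?y, z, ?y + x)] @ [(x, z, ?y + x)])
      (([(?y, z, ?y)] @ [(?y, z, x)]) @ ([(x, z, ?y)] @ [(x, z, x)]))"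
    using ext3_append[OF ext3_add3[of ?y z ?y x] ext3_add3[of x z ?y x]] by simp
  moreover have "ext3_rel (([(?y, z, ?y)] @ [(?y, z, x)]) @ ([(x, z, ?y)] @ [(x, z, x)]))
      (([] @ [(?y, z, x)]) @ ([(?y, z, x)] @ []))"
    by (intro ext3_append ext3_refl ext3_alt13 s)
  ultimately have 1: "ext3_rel [] [(?y, z, x), (?y, z, x)]"
    using ext3_sym[OF ext3_alt13] by simp (blast intro: ext3_trans)
  have "ext3_rel [(c *\<^sub>R x, z, x)] [(?y, z, x), (?y, z, x)]"
    using ext3_add1[of ?y ?y z x] by (simp flip: scaleR_add_left)
  with 1 show ?thesis by (meson ext3_sym ext3_trans)
qed

lemma ext3_rel_scale_map:
  "ext3_rel xs ys \<Longrightarrow>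
    ext3_rel (map (\<lambda>(x, y, z). (c *\<^sub>R x, y, z)) xs) (map (\<lambda>(x, y, z). (c *\<^sub>R x, y, z)) ys)"
proof (induction rule: ext3_rel.induct)
  case (ext3_sym xs ys)
  show ?case by (rule ext3_rel.ext3_sym) (rule ext3_sym.IH)
next
  case (ext3_trans xs ys zs)
  show ?case by (rule ext3_rel.ext3_trans) (rule ext3_trans.IH)+
next
  case (ext3_scale12 a x y z)
  show ?case using ext3_rel.ext3_scale12[of a "c *\<^sub>R x" y] by (simp add: mult.commute)
qed (auto simp: scaleR_add_right intro: ext3_refl ext3_append ext3_comm
    ext3_add1 ext3_add2 ext3_add3 ext3_scale23
    ext3_rel_alt12_scale ext3_alt23 ext3_rel_alt13_scale)

instantiation ext2 :: (real_vector) real_vector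
begin

lift_definition zero_ext2 :: "'a ext2" is "[]" .
lift_definition plus_ext2 :: "'a ext2 \<Rightarrow> 'a ext2 \<Rightarrow> 'a ext2" is "(@)"
  by (rule ext2_append)
lift_definition scaleR_ext2 :: "real \<Rightarrow> 'a ext2 \<Rightarrow> 'a ext2"
  is "\<lambda>c. map (\<lambda>(x, y). (c *\<^sub>R x, y))"
  by (rule ext2_rel_scale_map)
definition uminus_ext2 :: "'a ext2 \<Rightarrow> 'a ext2" where "uminus_ext2 r = (-1) *\<^sub>R r"
definition minus_ext2 :: "'a ext2 \<Rightarrow> 'a ext2 \<Rightarrow> 'a ext2" where "minus_ext2 r s = r + - s"

instance
proof
  fix a b c :: "'a ext2" and s t :: real
  show "a + b + c = a + (b + c)" by transfer (simp add: ext2_refl)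
  show comm: "a + b = b + a" for a b :: "'a ext2" by transfer (rule ext2_comm)
  show "0 + a = a" by transfer (simp add: ext2_refl)
  show add: "(s + t) *\<^sub>R a = s *\<^sub>R a + t *\<^sub>R a" for s t
  proof (transfer fixing: s t)
    fix xs :: "('a \<times> 'a) list"
    let ?m = "\<lambda>c. map (\<lambda>(x::'a, y::'a). (c *\<^sub>R x, y))"
    show "ext2_rel (?m (s + t) xs) (?m s xs @ ?m t xs)"
    proof (induction xs)
      case Nil
      show ?case by (simp add: ext2_refl)
    next
      case (Cons p xs)
      obtain x y where p: "p = (x, y)" by (cases p)
      have "ext2_rel ([((s + t) *\<^sub>R x, y)] @ ?m (s + t) xs)
          ([(s *\<^sub>R x, y), (t *\<^sub>R x, y)] @ (?m s xs @ ?m t xs))"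
        by (intro ext2_append Cons) (simp add: scaleR_add_left ext2_add1)
      moreover have "ext2_rel ([(s *\<^sub>R x, y)] @ (([(t *\<^sub>R x, y)] @ ?m s xs) @ ?m t xs))
         ([(s *\<^sub>R x, y)] @ ((?m s xs @ [(t *\<^sub>R x, y)]) @ ?m t xs))"
        by (intro ext2_append ext2_refl ext2_comm)
      ultimately show ?case unfolding p by simp (rule ext2_trans)
    qed
  qed
  show "- a + a = 0"
  proof -
    have z: "0 *\<^sub>R a = 0"
    proof transfer
      fix xs :: "('a \<times> 'a) list"
      show "ext2_rel (map (\<lambda>(x, y). (0 *\<^sub>R x, y)) xs) []"
      proof (induction xs)
        case Nil
        show ?case by (simp add: ext2_refl)
      next
        case (Cons p xs)
        obtain x y where p: "p = (x, y)" by (cases p)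
        show ?case using ext2_append[OF ext2_rel_zero[of y] Cons.IH] by (simp add: p)
      qed
    qed
    have o: "1 *\<^sub>R a = a" by transfer (simp add: ext2_refl)
    have "- a + a = (-1) *\<^sub>R a + 1 *\<^sub>R a" by (simp only: uminus_ext2_def o)
    also have "\<dots> = 0" using z by (simp flip: add)
    finally show ?thesis .
  qed
  show "a - b = a + - b" by (rule minus_ext2_def)
  show "s *\<^sub>R (a + b) = s *\<^sub>R a + s *\<^sub>R b" by transfer (simp add: ext2_refl)
  show "s *\<^sub>R t *\<^sub>R a = (s * t) *\<^sub>R a"
    by transfer (simp add: o_def case_prod_unfold ext2_refl)
  show "1 *\<^sub>R a = a" by transfer (simp add: ext2_refl)
qed

end

instantiation ext3 :: (real_vector) real_vector
begin

lift_definition zero_ext3 :: "'a ext3" is "[]" .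
lift_definition plus_ext3 :: "'a ext3 \<Rightarrow> 'a ext3 \<Rightarrow> 'a ext3" is "(@)"
  by (rule ext3_append)
lift_definition scaleR_ext3 :: "real \<Rightarrow> 'a ext3 \<Rightarrow> 'a ext3"
  is "\<lambda>c. map (\<lambda>(x, y, z). (c *\<^sub>R x, y, z))"
  by (rule ext3_rel_scale_map)
definition uminus_ext3 :: "'a ext3 \<Rightarrow> 'a ext3" where "uminus_ext3 r = (-1) *\<^sub>R r"
definition minus_ext3 :: "'a ext3 \<Rightarrow> 'a ext3 \<Rightarrow> 'a ext3" where "minus_ext3 r s = r + - s"

instance
proof
  fix a b c :: "'a ext3" and s t :: real
  show "a + b + c = a + (b + c)" by transfer (simp add: ext3_refl)
  show comm: "a + b = b + a" for a b :: "'a ext3" by transfer (rule ext3_comm)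
  show "0 + a = a" by transfer (simp add: ext3_refl)
  show add: "(s + t) *\<^sub>R a = s *\<^sub>R a + t *\<^sub>R a" for s t
  proof (transfer fixing: s t)
    fix xs :: "('a \<times> 'a \<times> 'a) list"
    let ?m = "\<lambda>c. map (\<lambda>(x::'a, y::'a, z::'a). (c *\<^sub>R x, y, z))"
    show "ext3_rel (?m (s + t) xs) (?m s xs @ ?m t xs)"
    proof (induction xs)
      case Nil
      show ?case by (simp add: ext3_refl)
    next
      case (Cons p xs)
      obtain x y z where p: "p = (x, y, z)" by (cases p)
      have "ext3_rel ([((s + t) *\<^sub>R x, y, z)] @ ?m (s + t) xs)
          ([(s *\<^sub>R x, y, z), (t *\<^sub>R x, y, z)] @ (?m s xs @ ?m t xs))"
        by (intro ext3_append Cons) (simp add: scaleR_add_left ext3_add1)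
      moreover have "ext3_rel ([(s *\<^sub>R x, y, z)] @ (([(t *\<^sub>R x, y, z)] @ ?m s xs) @ ?m t xs))
         ([(s *\<^sub>R x, y, z)] @ ((?m s xs @ [(t *\<^sub>R x, y, z)]) @ ?m t xs))"
        by (intro ext3_append ext3_refl ext3_comm)
      ultimately show ?case unfolding p by simp (rule ext3_trans)
    qed
  qed
  show "- a + a = 0"
  proof -
    have z: "0 *\<^sub>R a = 0"
    proof transfer
      fix xs :: "('a \<times> 'a \<times> 'a) list"
      show "ext3_rel (map (\<lambda>(x, y, z). (0 *\<^sub>R x, y, z)) xs) []"
      proof (induction xs)
        case Nil
        show ?case by (simp add: ext3_refl)
      next
        case (Cons p xs)
        obtain x y z where p: "p = (x, y, z)" by (cases p)
        show ?case using ext3_append[OF ext3_rel_zero[of y z] Cons.IH] by (simp add: p)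
      qed
    qed
    have o: "1 *\<^sub>R a = a" by transfer (simp add: case_prod_unfold ext3_refl)
    have "- a + a = (-1) *\<^sub>R a + 1 *\<^sub>R a" by (simp only: uminus_ext3_def o)
    also have "\<dots> = 0" using z by (simp flip: add)
    finally show ?thesis .
  qed
  show "a - b = a + - b" by (rule minus_ext3_def)
  show "s *\<^sub>R (a + b) = s *\<^sub>R a + s *\<^sub>R b" by transfer (simp add: ext3_refl)
  show "s *\<^sub>R t *\<^sub>R a = (s * t) *\<^sub>R a"
    by transfer (simp add: o_def case_prod_unfold ext3_refl)
  show "1 *\<^sub>R a = a" by transfer (simp add: case_prod_unfold ext3_refl)
qed

end

lift_definition wedge2 :: "'a::real_vector \<Rightarrow> 'a \<Rightarrow> 'a ext2" is "\<lambda>x y. [(x, y)]" .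

lift_definition wedge3 :: "'a::real_vector \<Rightarrow> 'a \<Rightarrow> 'a \<Rightarrow> 'a ext3" is "\<lambda>x y z. [(x, y, z)]" .

lemma wedge2_alt [simp]: "wedge2 x x = 0"
  by transfer (rule ext2_alt)

lemma bilinear_wedge2: "bilinear wedge2"
  unfolding bilinear_def
proof (intro conjI allI linearI)
  show "wedge2 (x + x') y = wedge2 x y + wedge2 x' y" for x x' y :: 'a
    by transfer (simp add: ext2_add1)
  show "wedge2 x (y + y') = wedge2 x y + wedge2 x y'" for x y y' :: 'a
    by transfer (simp add: ext2_add2)
  show "wedge2 (c *\<^sub>R x) y = c *\<^sub>R wedge2 x y" for c and x y :: 'a
    by transfer (simp add: ext2_refl)
  show "wedge2 x (c *\<^sub>R y) = c *\<^sub>R wedge2 x y" for c and x y :: 'a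
    by transfer (simp add: ext2_scale ext2_sym)
qed

lemma wedge3_alt [simp]:
  "wedge3 x x z = 0" "wedge3 x y y = 0" "wedge3 x y x = 0"
  by (transfer, rule ext3_alt12, transfer, rule ext3_alt23, transfer, rule ext3_alt13)

lemma wedge3_linear:
  "linear (\<lambda>x. wedge3 x y z)" "linear (\<lambda>y. wedge3 x y z)" "linear (\<lambda>z. wedge3 x y z)"
proof -
  have s1: "wedge3 (c *\<^sub>R x) y z = c *\<^sub>R wedge3 x y z" for c and x y z :: 'a
    by transfer (simp add: ext3_refl)
  have s2: "wedge3 x (c *\<^sub>R y) z = wedge3 (c *\<^sub>R x) y z" for c and x y z :: 'a
    by transfer (simp add: ext3_scale12 ext3_sym)
  have s3: "wedge3 x y (c *\<^sub>R z) = wedge3 x (c *\<^sub>R y) z" for c and x y z :: 'a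
    by transfer (simp add: ext3_scale23 ext3_sym)
  show "linear (\<lambda>x. wedge3 x y z)"
    by (rule linearI) (transfer, simp add: ext3_add1, rule s1)
  show "linear (\<lambda>y. wedge3 x y z)"
    by (rule linearI) (transfer, simp add: ext3_add2, simp only: s2 s1)
  show "linear (\<lambda>z. wedge3 x y z)"
    by (rule linearI) (transfer, simp add: ext3_add3, simp only: s3 s2 s1)
qed

lemma ext2_induct [case_names zero add]:
  assumes "P 0" "\<And>x y r. P r \<Longrightarrow> P (wedge2 x y + r)"
  shows "P r"
proof -
  have "P (abs_ext2 xs)" for xs
  proof (induction xs)
    case Nil
    then show ?case using assms(1) by (simp add: zero_ext2.abs_eq)
  next
    case (Cons p xs)
    then show ?case using assms(2)[of "abs_ext2 xs" "fst p" "snd p"]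
      by (simp add: wedge2.abs_eq plus_ext2.abs_eq)
  qed
  then show ?thesis by (metis Quotient3_abs_rep Quotient3_ext2)
qed

text \<open>
  The linear extension of a map on decomposable elements.  It does not depend on the
  chosen representative as soon as the map is bilinear and alternating
  (respectively trilinear and alternating).
\<close>

definition lift2 :: "('a::real_vector \<Rightarrow> 'a \<Rightarrow> 'c::real_vector) \<Rightarrow> 'a ext2 \<Rightarrow> 'c" where
  "lift2 \<phi> r = (\<Sum>(x, y)\<leftarrow>rep_ext2 r. \<phi> x y)"

definition lift3 :: "('a::real_vector \<Rightarrow> 'a \<Rightarrow> 'a \<Rightarrow> 'c::real_vector) \<Rightarrow> 'a ext3 \<Rightarrow> 'c" where
  "lift3 \<phi> r = (\<Sum>(x, y, z)\<leftarrow>rep_ext3 r. \<phi> x y z)"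

lemma ext2_rel_sum:
  assumes "bilinear \<phi>" "\<And>x. \<phi> x x = 0" "ext2_rel xs ys"
  shows "(\<Sum>(x, y)\<leftarrow>xs. \<phi> x y) = (\<Sum>(x, y)\<leftarrow>ys. \<phi> x y)"
  using assms(3)
  by induction (simp_all add: assms(2) bilinear_ladd[OF assms(1)] bilinear_radd[OF assms(1)]
      bilinear_lmul[OF assms(1)] bilinear_rmul[OF assms(1)])

lemma lift2_abs:
  assumes "bilinear \<phi>" "\<And>x. \<phi> x x = 0"
  shows "lift2 \<phi> (abs_ext2 xs) = (\<Sum>(x, y)\<leftarrow>xs. \<phi> x y)"
  unfolding lift2_def
  by (rule ext2_rel_sum[OF assms])
    (meson Quotient3_ext2 ext2.abs_eq_iff Quotient3_abs_rep Quotient3_rep_abs ext2_refl)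

lemma lift2_wedge2:
  assumes "bilinear \<phi>" "\<And>x. \<phi> x x = 0"
  shows "lift2 \<phi> (wedge2 x y) = \<phi> x y"
  using lift2_abs[OF assms, of "[(x, y)]"] by (simp add: wedge2.abs_eq)

lemma linear_lift2:
  assumes "bilinear \<phi>" "\<And>x. \<phi> x x = 0"
  shows "linear (lift2 \<phi>)"
proof -
  have abs: "\<exists>xs. r = abs_ext2 xs" for r :: "'a ext2"
    by (metis Quotient3_abs_rep Quotient3_ext2)
  show ?thesis
  proof (rule linearI)
    fix r s :: "'a ext2" and c :: real
    obtain xs ys where [simp]: "r = abs_ext2 xs" "s = abs_ext2 ys" using abs by metis
    show "lift2 \<phi> (r + s) = lift2 \<phi> r + lift2 \<phi> s"
      by (simp add: plus_ext2.abs_eq lift2_abs[OF assms])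
    have "(\<Sum>(x, y)\<leftarrow>map (\<lambda>(x, y). (c *\<^sub>R x, y)) xs. \<phi> x y) = c *\<^sub>R (\<Sum>(x, y)\<leftarrow>xs. \<phi> x y)"
      by (induction xs) (auto simp: bilinear_lmul[OF assms(1)] scaleR_add_right)
    then show "lift2 \<phi> (c *\<^sub>R r) = c *\<^sub>R lift2 \<phi> r"
      by (simp add: scaleR_ext2.abs_eq lift2_abs[OF assms])
  qed
qed

definition alternating3 :: "('a::real_vector \<Rightarrow> 'a \<Rightarrow> 'a \<Rightarrow> 'c::real_vector) \<Rightarrow> bool" where
  "alternating3 \<phi> \<longleftrightarrow>
    (\<forall>y z. linear (\<lambda>x. \<phi> x y z)) \<and> (\<forall>x z. linear (\<lambda>y. \<phi> x y z)) \<and> (\<forall>x y. linear (\<lambda>z. \<phi> x y z)) \<and>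
    (\<forall>x y. \<phi> x x y = 0 \<and> \<phi> x y y = 0 \<and> \<phi> x y x = 0)"

lemma ext3_rel_sum:
  assumes "alternating3 \<phi>" "ext3_rel xs ys"
  shows "(\<Sum>(x, y, z)\<leftarrow>xs. \<phi> x y z) = (\<Sum>(x, y, z)\<leftarrow>ys. \<phi> x y z)"
  using assms(2)
  by induction (use assms(1) in \<open>simp_all add: alternating3_def linear_iff\<close>)

lemma lift3_abs:
  assumes "alternating3 \<phi>"
  shows "lift3 \<phi> (abs_ext3 xs) = (\<Sum>(x, y, z)\<leftarrow>xs. \<phi> x y z)"
  unfolding lift3_def
  by (rule ext3_rel_sum[OF assms])
    (meson Quotient3_ext3 ext3.abs_eq_iff Quotient3_abs_rep Quotient3_rep_abs ext3_refl)

lemma lift3_wedge3: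
  assumes "alternating3 \<phi>"
  shows "lift3 \<phi> (wedge3 x y z) = \<phi> x y z"
  using lift3_abs[OF assms, of "[(x, y, z)]"] by (simp add: wedge3.abs_eq)

lemma linear_lift3:
  assumes "alternating3 \<phi>"
  shows "linear (lift3 \<phi>)"
proof -
  have abs: "\<exists>xs. r = abs_ext3 xs" for r :: "'a ext3"
    by (metis Quotient3_abs_rep Quotient3_ext3)
  show ?thesis
  proof (rule linearI)
    fix r s :: "'a ext3" and c :: real
    obtain xs ys where [simp]: "r = abs_ext3 xs" "s = abs_ext3 ys" using abs by metis
    show "lift3 \<phi> (r + s) = lift3 \<phi> r + lift3 \<phi> s"
      by (simp add: plus_ext3.abs_eq lift3_abs[OF assms])
    have "(\<Sum>(x, y, z)\<leftarrow>map (\<lambda>(x, y, z). (c *\<^sub>R x, y, z)) xs. \<phi> x y z)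
        = c *\<^sub>R (\<Sum>(x, y, z)\<leftarrow>xs. \<phi> x y z)"
      using assms by (induction xs) (auto simp: alternating3_def linear_iff scaleR_add_right)
    then show "lift3 \<phi> (c *\<^sub>R r) = c *\<^sub>R lift3 \<phi> r"
      by (simp add: scaleR_ext3.abs_eq lift3_abs[OF assms])
  qed
qed

text \<open>
  For bilinear alternating \<open>L\<close> both extensions are independent of representatives, and this
  is the unique bilinear map with the values \<open>schouten_wedge2\<close> on decomposables.
\<close>

definition schouten :: "('a::real_vector \<Rightarrow> 'a \<Rightarrow> 'a) \<Rightarrow> 'a ext2 \<Rightarrow> 'a ext2 \<Rightarrow> 'a ext3" where
  "schouten L r s = lift2 (\<lambda>x y. lift2 (\<lambda>z w.
     wedge3 (L x z) y w - wedge3 (L x w) y z - wedge3 (L y z) x w + wedge3 (L y w) x z) s) r"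

definition alternating2 :: "('a::real_vector \<Rightarrow> 'a \<Rightarrow> 'a) \<Rightarrow> bool" where
  "alternating2 L \<longleftrightarrow> bilinear L \<and> (\<forall>x. L x x = 0)"

lemma alternating2_skew: "alternating2 L \<Longrightarrow> L y x = - L x y"
proof -
  assume L: "alternating2 L"
  then have b: "bilinear L" and a: "L z z = 0" for z by (auto simp: alternating2_def)
  have "L (x + y) (x + y) = L x y + L y x"
    unfolding bilinear_ladd[OF b] bilinear_radd[OF b] by (simp add: a)
  with a show ?thesis by (metis add.commute eq_neg_iff_add_eq_0)
qed

lemmas wedge3_simps =
  wedge3_linear[THEN linear_add] wedge3_linear[THEN linear_diff]
  wedge3_linear[THEN linear_cmul] wedge3_linear[THEN linear_neg] wedge3_linear[THEN linear_0]

lemma wedge3_skew: "wedge3 y x z = - wedge3 x y z" "wedge3 x z y = - wedge3 x y z"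
proof -
  have "wedge3 (x + y) (x + y) z = wedge3 x y z + wedge3 y x z"
    "wedge3 x (y + z) (y + z) = wedge3 x y z + wedge3 x z y"
    unfolding wedge3_simps by simp_all
  then show "wedge3 y x z = - wedge3 x y z" "wedge3 x z y = - wedge3 x y z"
    by (simp_all add: eq_neg_iff_add_eq_0 add.commute)
qed

lemma lift2_add_fun: "lift2 (\<lambda>x y. \<phi> x y + \<psi> x y) r = lift2 \<phi> r + lift2 \<psi> r"
  by (simp add: lift2_def case_prod_unfold sum_list_addf)

lemma lift2_scale_fun: "lift2 (\<lambda>x y. c *\<^sub>R \<phi> x y) r = c *\<^sub>R lift2 \<phi> r"
proof -
  have "(\<Sum>(x, y)\<leftarrow>xs. c *\<^sub>R \<phi> x y) = c *\<^sub>R (\<Sum>(x, y)\<leftarrow>xs. \<phi> x y)" for xs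
    by (induction xs) (auto simp: scaleR_add_right)
  then show ?thesis by (simp add: lift2_def)
qed

context
  fixes L :: "'a::real_vector \<Rightarrow> 'a \<Rightarrow> 'a"
  assumes L: "alternating2 L"
begin

private lemma bil: "bilinear L" and alt: "L x x = 0"
  using L by (auto simp: alternating2_def)

private lemmas L_simps = bilinear_ladd[OF bil] bilinear_radd[OF bil]
  bilinear_lmul[OF bil] bilinear_rmul[OF bil]

private definition sch :: "'a \<Rightarrow> 'a \<Rightarrow> 'a \<Rightarrow> 'a \<Rightarrow> 'a ext3" where
  "sch x y z w =
     wedge3 (L x z) y w - wedge3 (L x w) y z - wedge3 (L y z) x w + wedge3 (L y w) x z"

private lemma schouten_sch: "schouten L r s = lift2 (\<lambda>x y. lift2 (sch x y) s) r"
  unfolding schouten_def sch_def ..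

private lemma sch_simps:
  "sch (x + x') y = (\<lambda>z w. sch x y z w + sch x' y z w)"
  "sch x (y + y') = (\<lambda>z w. sch x y z w + sch x y' z w)"
  "sch (c *\<^sub>R x) y = (\<lambda>z w. c *\<^sub>R sch x y z w)"
  "sch x (c *\<^sub>R y) = (\<lambda>z w. c *\<^sub>R sch x y z w)"
  "sch x x = (\<lambda>z w. 0)"
  by (auto simp: fun_eq_iff sch_def L_simps wedge3_simps algebra_simps)

private lemma inner_ok: "bilinear (sch x y)" "sch x y z z = 0"
  by (auto simp: bilinear_def linear_iff sch_def L_simps wedge3_simps algebra_simps)

private lemma outer_ok:
  "bilinear (\<lambda>x y. lift2 (sch x y) s)" "lift2 (sch x x) s = 0"
  unfolding bilinear_def linear_iff
  using lift2_scale_fun[of 0 "sch x x" s]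
  by (simp_all add: sch_simps lift2_add_fun lift2_scale_fun)

lemma schouten_wedge2:
  "schouten L (wedge2 x y) (wedge2 z w) =
     wedge3 (L x z) y w - wedge3 (L x w) y z - wedge3 (L y z) x w + wedge3 (L y w) x z"
proof -
  have "schouten L (wedge2 x y) (wedge2 z w) = lift2 (sch x y) (wedge2 z w)"
    unfolding schouten_sch by (rule lift2_wedge2[OF outer_ok])
  also have "\<dots> = sch x y z w"
    by (rule lift2_wedge2[OF inner_ok])
  finally show ?thesis by (simp only: sch_def)
qed

lemma bilinear_schouten: "bilinear (schouten L)"
  unfolding bilinear_def
proof (intro conjI allI)
  show "linear (\<lambda>r. schouten L r s)" for s
    unfolding schouten_sch by (rule linear_lift2[OF outer_ok])
  show "linear (schouten L r)" for r
    by (rule linearI)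
      (simp_all add: schouten_sch linear_add[OF linear_lift2[OF inner_ok]]
        linear_cmul[OF linear_lift2[OF inner_ok]] lift2_add_fun lift2_scale_fun)
qed

lemma schouten_commute: "schouten L r s = schouten L s r"
proof -
  note b = bilinear_schouten
  note b_simps = bilinear_lzero[OF b] bilinear_rzero[OF b] bilinear_ladd[OF b] bilinear_radd[OF b]
  have w: "schouten L (wedge2 x y) (wedge2 z w) = schouten L (wedge2 z w) (wedge2 x y)" for x y z w
    unfolding schouten_wedge2 alternating2_skew[OF L, of z] alternating2_skew[OF L, of w]
      wedge3_skew(2)[of _ w] wedge3_skew(2)[of _ z]
    by (simp add: wedge3_simps)
  have "schouten L (wedge2 x y) s = schouten L s (wedge2 x y)" for x y
    by (induction s rule: ext2_induct) (simp_all add: b_simps w)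
  then show ?thesis
    by (induction r rule: ext2_induct) (simp_all add: b_simps)
qed

end

typedef (overloaded) 'b dual = "{f :: 'b::real_vector \<Rightarrow> real. linear f}"
  morphisms dual_apply Abs_dual
  using linear_zero by blast

setup_lifting type_definition_dual

instantiation dual :: (real_vector) real_vector
begin

lift_definition zero_dual :: "'a dual" is "\<lambda>_. 0"
  by (rule linear_zero)
lift_definition plus_dual :: "'a dual \<Rightarrow> 'a dual \<Rightarrow> 'a dual" is "\<lambda>f g x. f x + g x"
  by (rule linear_compose_add)
lift_definition uminus_dual :: "'a dual \<Rightarrow> 'a dual" is "\<lambda>f x. - f x"
  by (rule linear_compose_neg)
lift_definition minus_dual :: "'a dual \<Rightarrow> 'a dual \<Rightarrow> 'a dual" is "\<lambda>f g x. f x - g x"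
  by (rule linear_compose_sub)
lift_definition scaleR_dual :: "real \<Rightarrow> 'a dual \<Rightarrow> 'a dual" is "\<lambda>c f x. c *\<^sub>R f x"
  by (rule linear_compose_scale_right)

instance
  by (standard; transfer; simp add: fun_eq_iff algebra_simps)

end

text \<open>
  The abelian Lie algebra is the whole type \<open>'b\<close> and \<open>V\<close> is the whole type \<open>'v\<close>.
  The planes are indexed by \<open>{1..num_planes}\<close>; each oriented Euclidean plane is
  given as the span of an orthonormal frame (\<open>frame1\<close>, \<open>frame2\<close>) declared to be positive.
\<close>

record (overloaded) ('b::real_vector, 'v) rot_datum =
  num_planes :: nat
  frame1 :: "nat \<Rightarrow> 'v"
  frame2 :: "nat \<Rightarrow> 'v"
  weight :: "nat \<Rightarrow> 'b dual"

definition plane :: "('b::real_vector, 'v::real_inner) rot_datum \<Rightarrow> nat \<Rightarrow> 'v set" where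
  "plane D l = span {frame1 D l, frame2 D l}"

definition rotational_datum :: "('b::real_vector, 'v::real_inner) rot_datum \<Rightarrow> bool" where
  "rotational_datum D \<longleftrightarrow>
     (\<exists>B :: 'b set. finite B \<and> span B = UNIV) \<and>
     (\<forall>l\<in>{1..num_planes D}. norm (frame1 D l) = 1 \<and> norm (frame2 D l) = 1 \<and>
        orthogonal (frame1 D l) (frame2 D l)) \<and>
     (\<forall>k\<in>{1..num_planes D}. \<forall>l\<in>{1..num_planes D}. k \<noteq> l \<longrightarrow>
        (\<forall>u\<in>plane D k. \<forall>v\<in>plane D l. orthogonal u v)) \<and>
     span (\<Union>l\<in>{1..num_planes D}. plane D l) = UNIV \<and>
     (\<forall>l\<in>{1..num_planes D}. weight D l \<noteq> 0)"

text \<open>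
  The positive quarter-turn of the plane with positive orthonormal frame \<open>(e, f)\<close>,
  extended by zero to the orthogonal complement of the plane.
\<close>

definition quarter_turn :: "'v::real_inner \<Rightarrow> 'v \<Rightarrow> 'v \<Rightarrow> 'v" where
  "quarter_turn e f u = (u \<bullet> e) *\<^sub>R f - (u \<bullet> f) *\<^sub>R e"

lemma quarter_turn_independent_of_frame:
  fixes e f e' f' :: "'v::real_inner"
  assumes frame: "norm e = 1" "norm f = 1" "orthogonal e f"
    and frame': "norm e' = 1" "norm f' = 1" "orthogonal e' f'"
    and same: "e' = a *\<^sub>R e + b *\<^sub>R f" "f' = c *\<^sub>R e + d *\<^sub>R f" and pos: "a * d - b * c > 0"
  shows "quarter_turn e' f' = quarter_turn e f"
proof -
  have i: "e \<bullet> e = 1" "f \<bullet> f = 1" "e \<bullet> f = 0" "f \<bullet> e = 0"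
    "e' \<bullet> e' = 1" "f' \<bullet> f' = 1" "e' \<bullet> f' = 0"
    using frame frame' by (auto simp: orthogonal_def inner_commute norm_eq_1)
  have "a * a + b * b = 1" "c * c + d * d = 1" "a * c + b * d = 0"
    using i(5-7) by (simp_all add: same inner_simps i mult.commute)
  moreover from this have "(a * d - b * c)\<^sup>2 = 1"
    by algebra
  ultimately have det: "a * d - b * c = 1"
    using pos by (simp add: power2_eq_1_iff)
  show ?thesis
  proof
    fix u
    have "quarter_turn e' f' u = (a * d - b * c) *\<^sub>R quarter_turn e f u"
      by (simp add: quarter_turn_def same inner_simps algebra_simps)
    with det show "quarter_turn e' f' u = quarter_turn e f u" by simp
  qed
qed

definition rho :: "('b::real_vector, 'v::real_inner) rot_datum \<Rightarrow> 'b \<Rightarrow> 'v \<Rightarrow> 'v" where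
  "rho D b u = (\<Sum>l\<in>{1..num_planes D}.
     dual_apply (weight D l) b *\<^sub>R quarter_turn (frame1 D l) (frame2 D l) u)"

lemma linear_dual_apply: "linear (dual_apply \<phi>)"
  using dual_apply by auto

lemma linear_quarter_turn: "linear (quarter_turn e f)"
  by (rule linearI) (simp_all add: quarter_turn_def inner_add_left scaleR_add_left
      scaleR_diff_right)

lemma bilinear_rho: "bilinear (rho D)"
  unfolding bilinear_def
proof (intro conjI allI)
  show "linear (rho D b)" for b
    unfolding rho_def
    by (intro linear_compose_sum ballI linear_compose_scale_right linear_quarter_turn)
  show "linear (\<lambda>b. rho D b u)" for u
    unfolding rho_def
    by (rule linearI) (simp_all add: linear_add[OF linear_dual_apply]
        linear_cmul[OF linear_dual_apply] scaleR_add_left sum.distrib scaleR_sum_right)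
qed

lemmas rho_simps = bilinear_ladd[OF bilinear_rho] bilinear_radd[OF bilinear_rho]
  bilinear_lmul[OF bilinear_rho] bilinear_rmul[OF bilinear_rho]
  bilinear_lzero[OF bilinear_rho] bilinear_rzero[OF bilinear_rho]

lemma rho_on_plane:
  assumes "rotational_datum D" "l \<in> {1..num_planes D}" "u \<in> plane D l"
  shows "rho D b u = dual_apply (weight D l) b *\<^sub>R quarter_turn (frame1 D l) (frame2 D l) u"
proof -
  have "quarter_turn (frame1 D k) (frame2 D k) u = 0" if "k \<in> {1..num_planes D} - {l}" for k
  proof -
    have "frame1 D k \<in> plane D k" "frame2 D k \<in> plane D k"
      by (auto simp: plane_def span_base)
    then have "orthogonal u (frame1 D k)" "orthogonal u (frame2 D k)"
      using assms that unfolding rotational_datum_def by (metis DiffE singletonI)+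
    then show ?thesis by (simp add: quarter_turn_def orthogonal_def)
  qed
  then show ?thesis
    unfolding rho_def by (subst sum.remove[OF _ assms(2)]) simp_all
qed

lift_definition beta :: "('b::real_vector, 'v::real_inner) rot_datum \<Rightarrow> 'v \<Rightarrow> 'v \<Rightarrow> 'b dual"
  is "\<lambda>D u v b. rho D b u \<bullet> v"
  by (auto simp: linear_iff rho_simps inner_add_left)

type_synonym ('b, 'v) lie = "'b \<times> 'v \<times> 'b dual"

definition inb :: "'b::real_vector \<Rightarrow> ('b, 'v::real_inner) lie" where
  "inb b = (b, 0, 0)"

definition inV :: "'v::real_inner \<Rightarrow> ('b::real_vector, 'v) lie" where
  "inV u = (0, u, 0)"

definition inz :: "'b::real_vector dual \<Rightarrow> ('b, 'v::real_inner) lie" where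
  "inz \<zeta> = (0, 0, \<zeta>)"

definition bracket ::
  "('b::real_vector, 'v::real_inner) rot_datum \<Rightarrow> ('b, 'v) lie \<Rightarrow> ('b, 'v) lie \<Rightarrow> ('b, 'v) lie" where
  "bracket D = (\<lambda>(b, u, \<zeta>) (b', u', \<zeta>'). (0, rho D b u' - rho D b' u, beta D u u'))"

lemma rho_skew: "rho D b u \<bullet> v = - (rho D b v \<bullet> u)"
proof -
  have "quarter_turn e f u \<bullet> v = - (quarter_turn e f v \<bullet> u)" for e f
    by (simp add: quarter_turn_def inner_diff_left inner_commute[of u] inner_commute[of v])
  then show ?thesis
    unfolding rho_def inner_sum_left sum_negf[symmetric] inner_scaleR_left
    by (metis (lifting) mult_minus_right)
qed

lemma beta_simps:
  "beta D (u + u') v = beta D u v + beta D u' v"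
  "beta D u (v + v') = beta D u v + beta D u v'"
  "beta D (c *\<^sub>R u) v = c *\<^sub>R beta D u v"
  "beta D u (c *\<^sub>R v) = c *\<^sub>R beta D u v"
  "beta D 0 v = 0" "beta D u 0 = 0"
  by (transfer, simp add: rho_simps inner_add_left inner_add_right)+

lemma beta_alt:
  fixes D :: "('b::real_vector, 'v::real_inner) rot_datum"
  shows "beta D u u = 0"
proof transfer
  fix D :: "('b, 'v) rot_datum" and u
  have "rho D b u \<bullet> u = 0" for b using rho_skew[of D b u u] by simp
  then show "(\<lambda>b. rho D b u \<bullet> u) = (\<lambda>_. 0)" by blast
qed

lemma alternating2_bracket: "alternating2 (bracket D)"
  unfolding alternating2_def bilinear_def linear_iff bracket_def
  by (auto simp: beta_simps rho_simps beta_alt scaleR_diff_right zero_prod_def)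

lemma bracket_simps:
  "bracket D (inb b) (inb b') = 0"
  "bracket D (inb b) (inV u) = inV (rho D b u)"
  "bracket D (inV u) (inV v) = inz (beta D u v)"
  "bracket D (inz \<zeta>) x = 0"
  by (auto simp: bracket_def inb_def inV_def inz_def rho_simps beta_simps zero_prod_def
      split: prod.split)

lemma rho_commute:
  assumes D: "rotational_datum D"
  shows "rho D b (rho D c u) = rho D c (rho D b u)"
proof -
  let ?J = "\<lambda>l. quarter_turn (frame1 D l) (frame2 D l)"
  have mem: "?J l v \<in> plane D l" for l v
    unfolding plane_def quarter_turn_def by (intro span_diff span_scale span_base) simp_all
  have lin: "linear (rho D b)" for b
    using bilinear_rho[of D] by (simp add: bilinear_def)
  have "rho D b (rho D c u) = (\<Sum>l\<in>{1..num_planes D}.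
      (dual_apply (weight D l) c * dual_apply (weight D l) b) *\<^sub>R ?J l (?J l u))" for b c
    unfolding rho_def[of D c] linear_sum[OF lin] linear_cmul[OF lin]
  proof (rule sum.cong[OF refl])
    fix l assume l: "l \<in> {1..num_planes D}"
    show "dual_apply (weight D l) c *\<^sub>R rho D b (?J l u)
        = (dual_apply (weight D l) c * dual_apply (weight D l) b) *\<^sub>R ?J l (?J l u)"
      unfolding rho_on_plane[OF D l mem[of l u]] scaleR_scaleR ..
  qed
  then show ?thesis by (simp add: mult.commute)
qed

lemma bracket_jacobi:
  assumes D: "rotational_datum D"
  shows "bracket D x (bracket D y z) + bracket D y (bracket D z x) + bracket D z (bracket D x y) = 0"
proof -
  obtain a u \<zeta> b v \<eta> c w \<theta> where xyz: "x = (a, u, \<zeta>)" "y = (b, v, \<eta>)" "z = (c, w, \<theta>)"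
    by (metis surj_pair)
  have diff: "rho D a (u - v) = rho D a u - rho D a v" for a u v
    using bilinear_rho[of D] by (simp add: bilinear_def linear_diff)
  have beta_diff: "beta D u (v - w) = beta D u v - beta D u w" for u v w
    by transfer (simp add: inner_diff_right)
  have sym: "beta D u (rho D b w) = beta D w (rho D b u)" for u b w
    using D
  proof transfer
    fix D :: "('a, 'b) rot_datum" and u b w
    assume D: "rotational_datum D"
    have "rho D a u \<bullet> rho D b w = rho D a w \<bullet> rho D b u" for a
      using rho_skew[of D b "rho D a u" w] rho_skew[of D a "rho D b u" w]
      by (simp add: rho_commute[OF D, of b a] inner_commute)
    then show "(\<lambda>a. rho D a u \<bullet> rho D b w) = (\<lambda>a. rho D a w \<bullet> rho D b u)" by blast
  qed
  have V: "rho D a (rho D b w - rho D c v) + rho D b (rho D c u - rho D a w)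
      + rho D c (rho D a v - rho D b u) = 0"
    by (simp add: diff rho_commute[OF D, of b a] rho_commute[OF D, of c a] rho_commute[OF D, of c b])
  have z: "beta D u (rho D b w - rho D c v) + beta D v (rho D c u - rho D a w)
      + beta D w (rho D a v - rho D b u) = 0"
    by (simp add: beta_diff sym[of u b] sym[of u c] sym[of v a])
  show ?thesis
    using V z by (simp add: xyz bracket_def rho_simps zero_prod_def)
qed

definition wedge_span :: "'a::real_vector set \<Rightarrow> 'a set \<Rightarrow> 'a ext2 set" where
  "wedge_span A B = span {wedge2 x y | x y. x \<in> A \<and> y \<in> B}"

abbreviation ext2_b :: "('b::real_vector, 'v::real_inner) lie ext2 set" where
  "ext2_b \<equiv> wedge_span (range inb) (range inb)"

abbreviation b_wedge_V :: "('b::real_vector, 'v::real_inner) lie ext2 set" where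
  "b_wedge_V \<equiv> wedge_span (range inb) (range inV)"

abbreviation ext2_V :: "('b::real_vector, 'v::real_inner) lie ext2 set" where
  "ext2_V \<equiv> wedge_span (range inV) (range inV)"

abbreviation z_wedge_g :: "('b::real_vector, 'v::real_inner) lie ext2 set" where
  "z_wedge_g \<equiv> wedge_span (range inz) UNIV"

abbreviation b_wedge_plane ::
  "('b::real_vector, 'v::real_inner) rot_datum \<Rightarrow> nat \<Rightarrow> ('b, 'v) lie ext2 set" where
  "b_wedge_plane D l \<equiv> wedge_span (range inb) (inV ` plane D l)"

text \<open>
  The descriptions below determine unique elements: see \<open>pr_bV_eq\<close> for the projection,
  \<open>block_eq\<close> (for a rotational datum) for the blocks, and \<open>block_line_eq\<close> for the line of
  a nonzero block of rank one.
\<close>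

definition pr_bV ::
  "('b::real_vector, 'v::real_inner) lie ext2 \<Rightarrow> ('b, 'v) lie ext2" where
  "pr_bV r = (THE p. p \<in> b_wedge_V \<and>
     (\<exists>s\<in>ext2_b. \<exists>q\<in>ext2_V. \<exists>c\<in>z_wedge_g. r = s + p + q + c))"

definition block ::
  "('b::real_vector, 'v::real_inner) rot_datum \<Rightarrow> ('b, 'v) lie ext2 \<Rightarrow> nat \<Rightarrow> ('b, 'v) lie ext2" where
  "block D p l = (THE q. \<exists>p'. (\<forall>k\<in>{1..num_planes D}. p' k \<in> b_wedge_plane D k) \<and>
     p = (\<Sum>k\<in>{1..num_planes D}. p' k) \<and> q = p' l)"

lemma wedge_span_wedge2: "x \<in> A \<Longrightarrow> y \<in> B \<Longrightarrow> wedge2 x y \<in> wedge_span A B"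
  by (auto simp: wedge_span_def intro: span_base)

lemma linear_eq_on_wedge_span:
  assumes "linear F" "linear G" "\<And>x y. x \<in> A \<Longrightarrow> y \<in> B \<Longrightarrow> F (wedge2 x y) = G (wedge2 x y)"
    and "r \<in> wedge_span A B"
  shows "F r = G r"
  using linear_eq_on[OF assms(1,2)] assms(3,4) unfolding wedge_span_def by blast

definition pr_map :: "('v \<Rightarrow> 'v) \<Rightarrow> ('b::real_vector, 'v::real_inner) lie ext2 \<Rightarrow> ('b, 'v) lie ext2" where
  "pr_map f = lift2 (\<lambda>x y. wedge2 (inb (fst x)) (inV (f (fst (snd y))))
     - wedge2 (inb (fst y)) (inV (f (fst (snd x)))))"

lemma linear_in: "linear inb" "linear inV" "linear inz"
  by (auto simp: linear_iff inb_def inV_def inz_def)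

lemmas wedge2_simps = bilinear_ladd[OF bilinear_wedge2] bilinear_radd[OF bilinear_wedge2]
  bilinear_lmul[OF bilinear_wedge2] bilinear_rmul[OF bilinear_wedge2]
  bilinear_lzero[OF bilinear_wedge2] bilinear_rzero[OF bilinear_wedge2]

lemmas in_simps = linear_in[THEN linear_add] linear_in[THEN linear_cmul] linear_in[THEN linear_0]

lemma fst_in [simp]:
  "fst (inb b) = b" "fst (snd (inb b)) = 0" "fst (inV u) = 0" "fst (snd (inV u)) = u"
  "fst (inz \<zeta>) = 0" "fst (snd (inz \<zeta>)) = 0"
  by (simp_all add: inb_def inV_def inz_def)

lemma wedge2_skew: "wedge2 y x = - wedge2 x y"
proof -
  have "wedge2 (x + y) (x + y) = wedge2 x y + wedge2 y x"
    unfolding wedge2_simps by simp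
  then show ?thesis by (simp add: eq_neg_iff_add_eq_0 add.commute)
qed

lemma pr_map:
  fixes f :: "'v::real_inner \<Rightarrow> 'v" and x y :: "('b::real_vector, 'v) lie"
  assumes "linear f"
  shows "linear (pr_map f :: ('b, 'v) lie ext2 \<Rightarrow> _)"
    and "pr_map f (wedge2 x y) = wedge2 (inb (fst x)) (inV (f (fst (snd y))))
     - wedge2 (inb (fst y)) (inV (f (fst (snd x))))"
proof -
  let ?\<phi> = "\<lambda>x y :: ('b, 'v) lie. wedge2 (inb (fst x)) (inV (f (fst (snd y))))
     - wedge2 (inb (fst y)) (inV (f (fst (snd x)))) :: ('b, 'v) lie ext2"
  have ok: "bilinear ?\<phi>" "?\<phi> x x = 0" for x
    unfolding bilinear_def linear_iff
    by (auto simp: wedge2_simps in_simps linear_add[OF assms] linear_cmul[OF assms] algebra_simps)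
  show "linear (pr_map f :: ('b, 'v) lie ext2 \<Rightarrow> _)"
    unfolding pr_map_def by (rule linear_lift2[OF ok])
  show "pr_map f (wedge2 x y) = wedge2 (inb (fst x)) (inV (f (fst (snd y))))
     - wedge2 (inb (fst y)) (inV (f (fst (snd x))))"
    unfolding pr_map_def by (rule lift2_wedge2[OF ok])
qed

lemma decomposition:
  "\<exists>s\<in>ext2_b. \<exists>q\<in>ext2_V. \<exists>c\<in>z_wedge_g. r = s + pr_map (\<lambda>v. v) r + q + c" and
  pr_map_in: "pr_map (\<lambda>v. v) r \<in> b_wedge_V"
proof -
  note lin = pr_map(1)[OF linear_ident] and w = pr_map(2)[OF linear_ident]
  have sub: "subspace (wedge_span A B)" for A B :: "('a, 'b) lie set"
    by (simp add: wedge_span_def)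
  note sub_add = subspace_add[OF sub]
  have "(\<exists>s\<in>ext2_b. \<exists>q\<in>ext2_V. \<exists>c\<in>z_wedge_g. r = s + pr_map (\<lambda>v. v) r + q + c) \<and> pr_map (\<lambda>v. v) r \<in> b_wedge_V"
  proof (induction r rule: ext2_induct)
    case zero
    show ?case
      using subspace_0[OF sub] by (auto simp: linear_0[OF lin] intro!: bexI[of _ 0])
  next
    case (add x y r)
    then obtain s q c where r: "s \<in> ext2_b" "q \<in> ext2_V" "c \<in> z_wedge_g" "r = s + pr_map (\<lambda>v. v) r + q + c"
      and p: "pr_map (\<lambda>v. v) r \<in> b_wedge_V" by blast
    obtain b u \<zeta> b' u' \<zeta>' where xy: "x = inb b + inV u + inz \<zeta>" "y = inb b' + inV u' + inz \<zeta>'"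
      by (cases x, cases y) (auto simp: inb_def inV_def inz_def)
    have e: "fst x = b" "fst (snd x) = u" "fst y = b'" "fst (snd y) = u'"
      by (simp_all add: xy inb_def inV_def inz_def)
    let ?s = "wedge2 (inb b) (inb b')" and ?q = "wedge2 (inV u) (inV u')"
      and ?c = "wedge2 (inz \<zeta>) y - wedge2 (inz \<zeta>') (inb b + inV u)"
    have "wedge2 x y = ?s + pr_map (\<lambda>v. v) (wedge2 x y) + ?q + ?c"
      unfolding w e unfolding xy wedge2_simps wedge2_skew[of "inV u" "inb b'"]
        wedge2_skew[of "inb b" "inz \<zeta>'"] wedge2_skew[of "inV u" "inz \<zeta>'"]
      by simp
    from this r(4) have "wedge2 x y + r = (?s + pr_map (\<lambda>v. v) (wedge2 x y) + ?q + ?c)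
        + (s + pr_map (\<lambda>v. v) r + q + c)"
      by (rule arg_cong2[where f = "(+)"])
    also have "\<dots> = (?s + s) + pr_map (\<lambda>v. v) (wedge2 x y + r) + (?q + q) + (?c + c)"
      unfolding linear_add[OF lin, of "wedge2 x y" r] by (simp only: add_ac)
    finally have "wedge2 x y + r = \<dots>" .
    moreover have "?s + s \<in> ext2_b" "?q + q \<in> ext2_V" "?c + c \<in> z_wedge_g"
      using r by (auto intro!: sub_add subspace_diff[OF sub] wedge_span_wedge2)
    moreover have "pr_map (\<lambda>v. v) (wedge2 x y + r) \<in> b_wedge_V"
      unfolding linear_add[OF lin] w
      using p by (auto intro!: sub_add subspace_diff[OF sub] wedge_span_wedge2)
    ultimately show ?case by blast
  qed
  then show "\<exists>s\<in>ext2_b. \<exists>q\<in>ext2_V. \<exists>c\<in>z_wedge_g. r = s + pr_map (\<lambda>v. v) r + q + c"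
    "pr_map (\<lambda>v. v) r \<in> b_wedge_V" by auto
qed

lemma pr_bV_unique:
  assumes "p \<in> b_wedge_V" "s \<in> ext2_b" "q \<in> ext2_V" "c \<in> z_wedge_g"
  shows "pr_map (\<lambda>v. v) (s + p + q + c) = p"
proof -
  note lin = pr_map(1)[OF linear_ident] and w = pr_map(2)[OF linear_ident]
  have "pr_map (\<lambda>v. v) p = id p"
    by (rule linear_eq_on_wedge_span[OF lin linear_id _ assms(1)])
      (auto simp: w in_simps wedge2_simps)
  moreover have "pr_map (\<lambda>v. v) s = 0"
    by (rule linear_eq_on_wedge_span[OF lin linear_zero _ assms(2)])
      (auto simp: w in_simps wedge2_simps)
  moreover have "pr_map (\<lambda>v. v) q = 0"
    by (rule linear_eq_on_wedge_span[OF lin linear_zero _ assms(3)])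
      (auto simp: w in_simps wedge2_simps)
  moreover have "pr_map (\<lambda>v. v) c = 0"
    by (rule linear_eq_on_wedge_span[OF lin linear_zero _ assms(4)])
      (auto simp: w in_simps wedge2_simps)
  ultimately show ?thesis by (simp add: linear_add[OF lin])
qed

lemma pr_bV_eq: "pr_bV r = pr_map (\<lambda>v. v) r"
  unfolding pr_bV_def
proof (rule the_equality)
  show "pr_map (\<lambda>v. v) r \<in> b_wedge_V \<and> (\<exists>s\<in>ext2_b. \<exists>q\<in>ext2_V. \<exists>c\<in>z_wedge_g.
      r = s + pr_map (\<lambda>v. v) r + q + c)"
    using decomposition pr_map_in by (rule conjI[rotated])
next
  fix p
  assume "p \<in> b_wedge_V \<and> (\<exists>s\<in>ext2_b. \<exists>q\<in>ext2_V. \<exists>c\<in>z_wedge_g. r = s + p + q + c)"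
  then obtain s q c where "p \<in> b_wedge_V" "s \<in> ext2_b" "q \<in> ext2_V" "c \<in> z_wedge_g"
    and r: "r = s + p + q + c" by blast
  then show "p = pr_map (\<lambda>v. v) r" unfolding r by (intro pr_bV_unique[symmetric])
qed

definition plane_proj :: "('b::real_vector, 'v::real_inner) rot_datum \<Rightarrow> nat \<Rightarrow> 'v \<Rightarrow> 'v" where
  "plane_proj D l u = (u \<bullet> frame1 D l) *\<^sub>R frame1 D l + (u \<bullet> frame2 D l) *\<^sub>R frame2 D l"

lemma linear_plane_proj: "linear (plane_proj D l)"
  by (auto simp: linear_iff plane_proj_def inner_simps algebra_simps)

lemma plane_proj_in: "plane_proj D l u \<in> plane D l"
  unfolding plane_proj_def plane_def by (intro span_add span_scale span_base) simp_all

lemma plane_proj: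
  assumes D: "rotational_datum D" and k: "k \<in> {1..num_planes D}" and l: "l \<in> {1..num_planes D}"
    and u: "u \<in> plane D k"
  shows "plane_proj D l u = (if k = l then u else 0)"
proof (cases "k = l")
  case True
  have i: "frame1 D l \<bullet> frame1 D l = 1" "frame2 D l \<bullet> frame2 D l = 1" "frame1 D l \<bullet> frame2 D l = 0"
    using D l unfolding rotational_datum_def orthogonal_def norm_eq_1 by auto
  have "plane_proj D l u = id u"
    by (rule linear_eq_on[OF linear_plane_proj linear_id, of _ "{frame1 D l, frame2 D l}"])
      (use u True i in \<open>auto simp: plane_def plane_proj_def inner_commute\<close>)
  with True show ?thesis by simp
next
  case False
  have "frame1 D l \<in> plane D l" "frame2 D l \<in> plane D l"
    by (auto simp: plane_def span_base)
  then have "orthogonal u (frame1 D l)" "orthogonal u (frame2 D l)"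
    using D k l u False unfolding rotational_datum_def by metis+
  with False show ?thesis by (simp add: plane_proj_def orthogonal_def)
qed

lemma sum_plane_proj:
  assumes D: "rotational_datum D"
  shows "(\<Sum>l\<in>{1..num_planes D}. plane_proj D l u) = u"
proof -
  let ?S = "\<lambda>u. \<Sum>l\<in>{1..num_planes D}. plane_proj D l u"
  have lin: "linear ?S" by (intro linear_compose_sum ballI linear_plane_proj)
  have "?S u = id u"
  proof (rule linear_eq_on[OF lin linear_id])
    show "u \<in> span (\<Union>l\<in>{1..num_planes D}. plane D l)"
      using D by (simp add: rotational_datum_def)
    fix v assume "v \<in> (\<Union>l\<in>{1..num_planes D}. plane D l)"
    then obtain k where k: "k \<in> {1..num_planes D}" "v \<in> plane D k" by blast
    have "?S v = (\<Sum>l\<in>{1..num_planes D}. if k = l then v else 0)"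
      by (intro sum.cong refl plane_proj[OF D]) (use k in auto)
    then show "?S v = id v" using k(1) by simp
  qed
  then show ?thesis by simp
qed

lemma pr_map_b_wedge_plane:
  assumes "rotational_datum D" "k \<in> {1..num_planes D}" "l \<in> {1..num_planes D}"
    and "q \<in> b_wedge_plane D k"
  shows "pr_map (plane_proj D l) q = (if k = l then q else 0)"
proof -
  note lin = pr_map(1)[OF linear_plane_proj] and w = pr_map(2)[OF linear_plane_proj]
  have "linear (\<lambda>q :: ('a, 'b) lie ext2. if k = l then q else 0)"
    by (auto simp: linear_iff)
  then show ?thesis
    by (rule linear_eq_on_wedge_span[OF lin _ _ assms(4)])
      (auto simp: w linear_0[OF linear_plane_proj] in_simps wedge2_simps
        plane_proj[OF assms(1,2,3)])
qed

lemma pr_map_in_b_wedge_plane: "pr_map (plane_proj D k) r \<in> b_wedge_plane D k"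
proof -
  note lin = pr_map(1)[OF linear_plane_proj[of D k]] and w = pr_map(2)[OF linear_plane_proj[of D k]]
  have sub: "subspace (b_wedge_plane D k)"
    by (simp add: wedge_span_def)
  show ?thesis
    by (induction r rule: ext2_induct)
      (auto simp: linear_0[OF lin] linear_add[OF lin] w intro!: subspace_0[OF sub]
        subspace_add[OF sub] subspace_diff[OF sub] wedge_span_wedge2 plane_proj_in)
qed

lemma sum_pr_map:
  fixes D :: "('b::real_vector, 'v::real_inner) rot_datum" and p :: "('b, 'v) lie ext2"
  assumes D: "rotational_datum D" and p: "p \<in> b_wedge_V"
  shows "p = (\<Sum>k\<in>{1..num_planes D}. pr_map (plane_proj D k) p)"
proof -
  note lin = pr_map(1)[OF linear_plane_proj] and w = pr_map(2)[OF linear_plane_proj]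
  let ?G = "\<lambda>p :: ('b, 'v) lie ext2. \<Sum>k\<in>{1..num_planes D}. pr_map (plane_proj D k) p"
  have "linear ?G" by (intro linear_compose_sum ballI lin)
  moreover have "id (wedge2 x y) = ?G (wedge2 x y)"
    if xy: "x \<in> range inb" "y \<in> range inV" for x y :: "('b, 'v) lie"
  proof -
    obtain b u where [simp]: "x = inb b" "y = inV u" using xy by blast
    have "?G (wedge2 x y) = (\<Sum>k\<in>{1..num_planes D}. wedge2 (inb b) (inV (plane_proj D k u)))"
      by (simp add: w in_simps wedge2_simps)
    also have "\<dots> = wedge2 (inb b) (inV (\<Sum>k\<in>{1..num_planes D}. plane_proj D k u))"
    proof -
      have lw: "linear (wedge2 (inb b :: ('b, 'v) lie))"
        using bilinear_wedge2 unfolding bilinear_def by blast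
      show ?thesis unfolding linear_sum[OF linear_in(2)] by (rule linear_sum[OF lw, symmetric])
    qed
    finally show ?thesis unfolding sum_plane_proj[OF D] id_apply by simp
  qed
  ultimately have "id p = ?G p"
    by (intro linear_eq_on_wedge_span[OF linear_id _ _ p])
  then show ?thesis by simp
qed

lemma block_eq:
  assumes D: "rotational_datum D" and l: "l \<in> {1..num_planes D}" and p: "p \<in> b_wedge_V"
  shows "block D p l = pr_map (plane_proj D l) p"
  unfolding block_def
proof (rule the_equality)
  show "\<exists>p'. (\<forall>k\<in>{1..num_planes D}. p' k \<in> b_wedge_plane D k) \<and>
      p = (\<Sum>k\<in>{1..num_planes D}. p' k) \<and> pr_map (plane_proj D l) p = p' l"
    using sum_pr_map[OF D p] pr_map_in_b_wedge_plane
    by (intro exI[of _ "\<lambda>k. pr_map (plane_proj D k) p"]) blast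
next
  fix q
  assume "\<exists>p'. (\<forall>k\<in>{1..num_planes D}. p' k \<in> b_wedge_plane D k) \<and>
    p = (\<Sum>k\<in>{1..num_planes D}. p' k) \<and> q = p' l"
  then obtain p' where p': "\<forall>k\<in>{1..num_planes D}. p' k \<in> b_wedge_plane D k"
    "p = (\<Sum>k\<in>{1..num_planes D}. p' k)" "q = p' l" by blast
  have "pr_map (plane_proj D l) p = (\<Sum>k\<in>{1..num_planes D}. if k = l then p' k else 0)"
    unfolding p'(2) linear_sum[OF pr_map(1)[OF linear_plane_proj]]
    by (intro sum.cong refl pr_map_b_wedge_plane[OF D]) (use p' l in auto)
  then show "q = pr_map (plane_proj D l) p"
    using l p'(3) by simp
qed

text \<open>
  Tensor rank is transported along the isomorphism \<open>h \<otimes> u \<mapsto> h \<and> u\<close> from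
  the tensor product of \<open>'b\<close> with the plane \<open>l\<close> onto \<open>b_wedge_plane D l\<close>.
\<close>

definition tensor_rank ::
  "('b::real_vector, 'v::real_inner) rot_datum \<Rightarrow> nat \<Rightarrow> ('b, 'v) lie ext2 \<Rightarrow> nat" where
  "tensor_rank D l q = (LEAST n. \<exists>h u. (\<forall>i<n. u i \<in> plane D l) \<and>
     q = (\<Sum>i<n. wedge2 (inb (h i)) (inV (u i))))"

definition rank_one_locus ::
  "('b::real_vector, 'v::real_inner) rot_datum \<Rightarrow> ('b, 'v) lie ext2 set" where
  "rank_one_locus D =
     {p \<in> b_wedge_V. \<forall>l\<in>{1..num_planes D}. tensor_rank D l (block D p l) \<le> 1}"

definition block_line ::
  "('b::real_vector, 'v::real_inner) rot_datum \<Rightarrow> nat \<Rightarrow> ('b, 'v) lie ext2 \<Rightarrow> 'b set" where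
  "block_line D l q =
     (THE L. \<exists>h. \<exists>u\<in>plane D l. q = wedge2 (inb h) (inV u) \<and> L = span {h})"

definition weight_kernel :: "('b::real_vector, 'v) rot_datum \<Rightarrow> nat \<Rightarrow> 'b set" where
  "weight_kernel D l = {b. dual_apply (weight D l) b = 0}"

definition null_locus ::
  "('b::real_vector, 'v::real_inner) rot_datum \<Rightarrow> ('b, 'v) lie ext2 set" where
  "null_locus D = {p \<in> rank_one_locus D. \<forall>l\<in>{1..num_planes D}.
     block D p l \<noteq> 0 \<longrightarrow> block_line D l (block D p l) \<subseteq> weight_kernel D l}"

definition nonnull_locus ::
  "('b::real_vector, 'v::real_inner) rot_datum \<Rightarrow> ('b, 'v) lie ext2 set" where
  "nonnull_locus D = {p \<in> rank_one_locus D. \<forall>l\<in>{1..num_planes D}.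
     block D p l \<noteq> 0 \<longrightarrow> \<not> block_line D l (block D p l) \<subseteq> weight_kernel D l}"

definition split_space ::
  "('b::real_vector, 'v::real_inner) rot_datum \<Rightarrow> (nat \<Rightarrow> 'b) \<Rightarrow> ('b, 'v) lie ext2 set" where
  "split_space D h = {\<Sum>l\<in>{1..num_planes D}. wedge2 (inb (h l)) (inV (u l)) | u.
     \<forall>l\<in>{1..num_planes D}. u l \<in> plane D l}"

lemma tensor_rank_le_1_iff:
  assumes "q \<in> b_wedge_plane D l"
  shows "tensor_rank D l q \<le> 1 \<longleftrightarrow> (\<exists>h. \<exists>u\<in>plane D l. q = wedge2 (inb h) (inV u))"
    (is "_ \<longleftrightarrow> ?R")
proof -
  let ?P = "\<lambda>q (n::nat). \<exists>h u. (\<forall>i<n. u i \<in> plane D l) \<and> q = (\<Sum>i<n. wedge2 (inb (h i)) (inV (u i)))"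
  have ex: "\<exists>n. ?P q n"
    using assms unfolding wedge_span_def
  proof (induction rule: span_induct_alt)
    case base
    show ?case by (rule exI[of _ "0::nat"]) simp
  next
    case (step c x y)
    then obtain h u where x: "x = wedge2 (inb h) (inV u)" and u: "u \<in> plane D l" by blast
    from step.IH obtain n :: nat and h' u' where y: "\<forall>i<n. u' i \<in> plane D l"
      "y = (\<Sum>i<n. wedge2 (inb (h' i)) (inV (u' i)))" by auto
    have "c *\<^sub>R x + y = (\<Sum>i<Suc n. wedge2 (inb ((h'(n := c *\<^sub>R h)) i)) (inV ((u'(n := u)) i)))"
      by (simp add: x y in_simps wedge2_simps)
    moreover have "\<forall>i<Suc n. (u'(n := u)) i \<in> plane D l"
      using u y by simp
    ultimately show ?case by blast
  qed
  have "?P q 0 \<Longrightarrow> ?R"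
  proof -
    assume "?P q 0"
    then have "q = wedge2 (inb 0) (inV 0)" by (simp add: in_simps wedge2_simps)
    moreover have "0 \<in> plane D l" by (simp add: plane_def span_0)
    ultimately show ?R by blast
  qed
  moreover have "?P q 1 \<longleftrightarrow> ?R"
  proof
    assume ?R
    then obtain h u where "u \<in> plane D l" "q = wedge2 (inb h) (inV u)" by blast
    then show "?P q 1" by (intro exI[of _ "\<lambda>_. h"] exI[of _ "\<lambda>_. u"]) simp
  qed auto
  moreover have "?P q (tensor_rank D l q)"
    unfolding tensor_rank_def by (rule LeastI_ex[OF ex])
  moreover have "?P q 1 \<Longrightarrow> tensor_rank D l q \<le> 1"
    unfolding tensor_rank_def by (rule Least_le)
  ultimately show ?thesis
    by (cases "tensor_rank D l q = 0"; cases "tensor_rank D l q = 1") auto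
qed

lemma factor_line_unique:
  assumes eq: "wedge2 (inb h) (inV u) = (wedge2 (inb h') (inV u') :: ('b::real_vector, 'v::real_inner) lie ext2)"
    and nz: "wedge2 (inb h) (inV u) \<noteq> (0 :: ('b, 'v) lie ext2)"
  shows "span {h} = span {h'}"
proof -
  have mem: "h \<in> span {h'}"
    if eq: "wedge2 (inb h) (inV u) = (wedge2 (inb h') (inV u') :: ('b, 'v) lie ext2)"
      and u: "u \<noteq> 0" for h h' :: 'b and u u' :: 'v
  proof -
    let ?x = "(u \<bullet> u) *\<^sub>R h - (u' \<bullet> u) *\<^sub>R h'"
    have "f h * (u \<bullet> u) = f h' * (u' \<bullet> u)" if f: "linear f" for f :: "'b \<Rightarrow> real"
    proof -
      let ?\<phi> = "\<lambda>x y :: ('b, 'v) lie.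
        f (fst x) * (fst (snd y) \<bullet> u) - f (fst y) * (fst (snd x) \<bullet> u)"
      have ok: "bilinear ?\<phi>" "?\<phi> x x = 0" for x
        unfolding bilinear_def linear_iff
        by (auto simp: linear_add[OF f] linear_cmul[OF f] inner_simps algebra_simps)
      have w: "lift2 ?\<phi> (wedge2 (inb h) (inV v)) = f h * (v \<bullet> u)" for h v
        unfolding lift2_wedge2[OF ok] by (simp add: inb_def inV_def linear_0[OF f])
      from arg_cong[OF eq, of "lift2 ?\<phi>"] show ?thesis by (simp only: w)
    qed
    then have f0: "f ?x = 0" if "linear f" for f :: "'b \<Rightarrow> real"
      using that by (simp add: linear_diff[OF that] linear_cmul[OF that] mult.commute)
    have "?x = 0"
    proof (rule ccontr)
      assume "?x \<noteq> 0"
      then have "independent {?x}" by simp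
      from linear_independent_extend[OF this, of "\<lambda>_. 1::real"]
      obtain f :: "'b \<Rightarrow> real" where "linear f" "f ?x = 1" by auto
      then show False using f0[of f] by (simp only:)
    qed
    then have e: "(u \<bullet> u) *\<^sub>R h = (u' \<bullet> u) *\<^sub>R h'" by simp
    have "h = inverse (u \<bullet> u) *\<^sub>R ((u \<bullet> u) *\<^sub>R h)" using u by simp
    also have "\<dots> = (inverse (u \<bullet> u) * (u' \<bullet> u)) *\<^sub>R h'" by (simp only: e scaleR_scaleR)
    finally have "h = (inverse (u \<bullet> u) * (u' \<bullet> u)) *\<^sub>R h'" .
    then show ?thesis by (auto simp: span_singleton)
  qed
  have "u \<noteq> 0" "u' \<noteq> 0"
    using nz eq by (auto simp: in_simps wedge2_simps)
  from mem[OF eq this(1)] mem[OF eq[symmetric] this(2)] show ?thesis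
    by (simp add: span_eq)
qed

lemma block_line_eq:
  assumes "u \<in> plane D l" "wedge2 (inb h) (inV u) \<noteq> (0 :: ('b::real_vector, 'v::real_inner) lie ext2)"
  shows "block_line (D :: ('b, 'v) rot_datum) l (wedge2 (inb h) (inV u)) = span {h}"
  unfolding block_line_def
  by (rule the_equality) (use assms factor_line_unique in blast)+

end

theory Submission
  imports Defs
begin

text \<open>
  Each plane \<open>l\<close> gives a homomorphism from the Lie algebra onto the Lie algebra of rigid motions
  of the Euclidean plane (onto, because \<open>\<lambda>\<^sub>l \<noteq> 0\<close>): send \<open>b + u + \<zeta>\<close> to the angular velocity \<open>\<lambda>\<^sub>l b\<close> together with the two
  coordinates of the component of \<open>u\<close> in the plane.  The centre is killed, and so are the other planes.
  The motion algebra is three-dimensional, so its third exterior power is a line; there the Schouten bracket is a single real bilinear form, and a direct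
  computation identifies it as twice the Euclidean inner product of the contractions of its
  two arguments with the angular velocity (\<open>motion_volume_schouten\<close>).

  Hence \<open>[r, r] = 0\<close> forces a squared norm to vanish: the contraction of \<open>r\<close> by \<open>\<lambda>\<^sub>l\<close>, projected to the
  plane \<open>l\<close>, is zero (\<open>weight_contraction_eq_0\<close>).  This contraction sees only the
  block of \<open>r\<close> at \<open>l\<close>, which is why no other component of \<open>r\<close> can compensate for it.
  On a rank-one block \<open>h \<and> u\<close> it has the value \<open>\<lambda>\<^sub>l(h) u\<close>, so that \<open>\<lambda>\<^sub>l(h) = 0\<close> unless the
  block vanishes.  If \<open>dim \<bb> = 1\<close>, every block has rank at most one and
  \<open>\<lambda>\<^sub>l\<close> is injective, so all blocks vanish.
\<close>

section \<open>The quotient onto the motions of one plane\<close>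

text \<open>
  A triple \<open>(a, x, y)\<close> stands for the infinitesimal motion with angular velocity \<open>a\<close> and
  translation part \<open>(x, y)\<close>.
\<close>

fun motion_bracket :: "real \<times> real \<times> real \<Rightarrow> real \<times> real \<times> real \<Rightarrow> real \<times> real \<times> real" where
  "motion_bracket (a, x, y) (a', x', y') = (0, a' * y - a * y', a * x' - a' * x)"

fun det3 :: "real \<times> real \<times> real \<Rightarrow> real \<times> real \<times> real \<Rightarrow> real \<times> real \<times> real \<Rightarrow> real" where
  "det3 (a, x, y) (a', x', y') (a'', x'', y'') =
     a * (x' * y'' - x'' * y') - a' * (x * y'' - x'' * y) + a'' * (x * y' - x' * y)"

definition motion_part ::
  "('b::real_vector, 'v::real_inner) rot_datum \<Rightarrow> nat \<Rightarrow> ('b, 'v) lie \<Rightarrow> real \<times> real \<times> real" where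
  "motion_part D l x =
     (dual_apply (weight D l) (fst x), fst (snd x) \<bullet> frame1 D l, fst (snd x) \<bullet> frame2 D l)"

definition motion_volume ::
  "('b::real_vector, 'v::real_inner) rot_datum \<Rightarrow> nat \<Rightarrow> ('b, 'v) lie \<Rightarrow> ('b, 'v) lie \<Rightarrow> ('b, 'v) lie \<Rightarrow> real" where
  "motion_volume D l x y z = det3 (motion_part D l x) (motion_part D l y) (motion_part D l z)"

lemma alternating3_motion_volume: "alternating3 (motion_volume D l)"
  unfolding alternating3_def linear_iff motion_volume_def motion_part_def
  by (simp add: linear_add[OF linear_dual_apply] linear_cmul[OF linear_dual_apply]
      inner_simps algebra_simps)

lemma frame_inner:
  assumes "rotational_datum D" "l \<in> {1..num_planes D}"
  shows "frame1 D l \<bullet> frame1 D l = 1" "frame2 D l \<bullet> frame2 D l = 1"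
    "frame1 D l \<bullet> frame2 D l = 0" "frame2 D l \<bullet> frame1 D l = 0"
  using assms unfolding rotational_datum_def orthogonal_def norm_eq_1
  by (auto simp: inner_commute)

lemma rho_inner_frame:
  assumes D: "rotational_datum D" and l: "l \<in> {1..num_planes D}"
  shows "rho D b u \<bullet> frame1 D l = - (dual_apply (weight D l) b * (u \<bullet> frame2 D l))"
    and "rho D b u \<bullet> frame2 D l = dual_apply (weight D l) b * (u \<bullet> frame1 D l)"
proof -
  have frame: "frame1 D l \<in> plane D l" "frame2 D l \<in> plane D l"
    by (auto simp: plane_def span_base)
  show "rho D b u \<bullet> frame1 D l = - (dual_apply (weight D l) b * (u \<bullet> frame2 D l))"
    "rho D b u \<bullet> frame2 D l = dual_apply (weight D l) b * (u \<bullet> frame1 D l)"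
    \<comment> \<open>By skewness the rotation can be moved to the frame vector, where it is a quarter-turn.\<close>
    unfolding rho_skew[of D b u] rho_on_plane[OF D l frame(1)] rho_on_plane[OF D l frame(2)]
    by (simp_all add: quarter_turn_def frame_inner[OF D l] inner_simps inner_commute)
qed

lemma motion_part_bracket:
  assumes "rotational_datum D" "l \<in> {1..num_planes D}"
  shows "motion_part D l (bracket D x y) = motion_bracket (motion_part D l x) (motion_part D l y)"
  by (cases x; cases y)
    (simp add: motion_part_def bracket_def rho_inner_frame[OF assms] inner_diff_left
      linear_0[OF linear_dual_apply])

section \<open>Contraction by a weight\<close>

definition weight_contraction ::
  "('b::real_vector, 'v::real_inner) rot_datum \<Rightarrow> nat \<Rightarrow> ('b, 'v) lie ext2 \<Rightarrow> 'v" where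
  "weight_contraction D l = lift2 (\<lambda>x y.
     dual_apply (weight D l) (fst x) *\<^sub>R plane_proj D l (fst (snd y))
     - dual_apply (weight D l) (fst y) *\<^sub>R plane_proj D l (fst (snd x)))"

lemma linear_weight_contraction:
    "linear (weight_contraction D l)" (is ?lin)
  and weight_contraction_wedge2:
    "weight_contraction D l (wedge2 x y) =
      dual_apply (weight D l) (fst x) *\<^sub>R plane_proj D l (fst (snd y))
      - dual_apply (weight D l) (fst y) *\<^sub>R plane_proj D l (fst (snd x))" (is ?wedge)
proof -
  let ?\<phi> = "\<lambda>x y. dual_apply (weight D l) (fst x) *\<^sub>R plane_proj D l (fst (snd y))
     - dual_apply (weight D l) (fst y) *\<^sub>R plane_proj D l (fst (snd x))"
  have ok: "bilinear ?\<phi>" "?\<phi> x x = 0" for x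
    unfolding bilinear_def linear_iff
    by (auto simp: linear_add[OF linear_dual_apply] linear_cmul[OF linear_dual_apply]
        linear_add[OF linear_plane_proj] linear_cmul[OF linear_plane_proj] algebra_simps)
  show ?lin unfolding weight_contraction_def by (rule linear_lift2[OF ok])
  show ?wedge unfolding weight_contraction_def by (rule lift2_wedge2[OF ok])
qed

lemma weight_contraction_in_wedge:
  assumes "rotational_datum D" "l \<in> {1..num_planes D}" "u \<in> plane D l"
  shows "weight_contraction D l (wedge2 (inb h) (inV u)) = dual_apply (weight D l) h *\<^sub>R u"
  using plane_proj[OF assms(1,2,2,3)]
  by (simp add: weight_contraction_wedge2 linear_0[OF linear_dual_apply])

text \<open>
  The contraction pairs an angular velocity with a vector of the plane \<open>l\<close>, so of all the components
  of \<open>r\<close> only its block at \<open>l\<close> contributes.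
\<close>

lemma weight_contraction_block:
  assumes D: "rotational_datum D" and l: "l \<in> {1..num_planes D}"
  shows "weight_contraction D l (block D (pr_bV r) l) = weight_contraction D l r"
proof -
  note lin = linear_weight_contraction pr_map(1)[OF linear_ident] pr_map(1)[OF linear_plane_proj]
  have idem: "plane_proj D l (plane_proj D l u) = plane_proj D l u" for u
    using plane_proj[OF D l l plane_proj_in] by simp
  have "weight_contraction D l (pr_map (plane_proj D l) (pr_map (\<lambda>v. v) r)) = weight_contraction D l r"
  proof (induction r rule: ext2_induct)
    case zero
    show ?case by (simp add: lin[THEN linear_0])
  next
    case (add x y r)
    then show ?case
      by (simp add: lin[THEN linear_add] lin[THEN linear_diff] pr_map(2)[OF linear_ident]
          pr_map(2)[OF linear_plane_proj] weight_contraction_wedge2 idem in_simps wedge2_simps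
          linear_0[OF linear_dual_apply] linear_0[OF linear_plane_proj])
  qed
  then show ?thesis
    unfolding pr_bV_eq block_eq[OF D l pr_map_in] .
qed

section \<open>The Schouten bracket in the motion algebra\<close>

text \<open>
  Both sides are bilinear, so it suffices to compare them on decomposables; as \<open>motion_part\<close>
  is a homomorphism, this becomes a polynomial identity between the coordinates of four motions.
\<close>

lemma motion_volume_schouten:
  fixes D :: "('b::real_vector, 'v::real_inner) rot_datum"
  assumes D: "rotational_datum D" and l: "l \<in> {1..num_planes D}"
  shows "lift3 (motion_volume D l) (schouten (bracket D) r s) =
    2 * (weight_contraction D l r \<bullet> weight_contraction D l s)"
proof -
  note lift = linear_lift3[OF alternating3_motion_volume[of D l]]
  note bil = bilinear_schouten[OF alternating2_bracket[of D]]
  note con = linear_weight_contraction[of D l]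
  have inner: "plane_proj D l u \<bullet> plane_proj D l v =
      (u \<bullet> frame1 D l) * (v \<bullet> frame1 D l) + (u \<bullet> frame2 D l) * (v \<bullet> frame2 D l)" for u v
    by (simp add: plane_proj_def inner_simps frame_inner[OF D l])
  have wedges: "lift3 (motion_volume D l) (schouten (bracket D) (wedge2 x y) (wedge2 z w)) =
    2 * (weight_contraction D l (wedge2 x y) \<bullet> weight_contraction D l (wedge2 z w))" for x y z w
    unfolding schouten_wedge2[OF alternating2_bracket] linear_add[OF lift] linear_diff[OF lift]
      lift3_wedge3[OF alternating3_motion_volume] motion_volume_def motion_part_bracket[OF D l]
      weight_contraction_wedge2
    by (simp add: motion_part_def inner_diff_left inner_diff_right inner algebra_simps)
  have "lift3 (motion_volume D l) (schouten (bracket D) (wedge2 x y) s) =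
    2 * (weight_contraction D l (wedge2 x y) \<bullet> weight_contraction D l s)" for x y
    by (induction s rule: ext2_induct)
      (simp_all add: bilinear_rzero[OF bil] bilinear_radd[OF bil] linear_0[OF lift]
        linear_add[OF lift] linear_0[OF con] linear_add[OF con] wedges inner_add_right)
  then show ?thesis
    by (induction r rule: ext2_induct)
      (simp_all add: bilinear_lzero[OF bil] bilinear_ladd[OF bil] linear_0[OF lift]
        linear_add[OF lift] linear_0[OF con] linear_add[OF con] inner_add_left)
qed

lemma weight_contraction_eq_0:
  assumes "rotational_datum D" "l \<in> {1..num_planes D}" "schouten (bracket D) r r = 0"
  shows "weight_contraction D l r = 0"
  using motion_volume_schouten[OF assms(1,2), of r r]
  by (simp add: assms(3) linear_0[OF linear_lift3[OF alternating3_motion_volume]])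

section \<open>Rank-one blocks\<close>

lemma weight_eq_0_of_block_factor:
  assumes D: "rotational_datum D" and l: "l \<in> {1..num_planes D}"
    and r: "schouten (bracket D) r r = 0" and u: "u \<in> plane D l"
    and eq: "block D (pr_bV r) l = wedge2 (inb h) (inV u)" and nz: "block D (pr_bV r) l \<noteq> 0"
  shows "dual_apply (weight D l) h = 0"
proof -
  have "dual_apply (weight D l) h *\<^sub>R u = 0"
    using weight_contraction_block[OF D l, of r] weight_contraction_eq_0[OF D l r]
    by (simp add: eq weight_contraction_in_wedge[OF D l u])
  moreover have "u \<noteq> 0"
    using nz by (auto simp: eq in_simps wedge2_simps)
  ultimately show ?thesis by simp
qed

lemma span_singleton_subset_weight_kernel:
  "span {h} \<subseteq> weight_kernel D l \<longleftrightarrow> dual_apply (weight D l) h = 0"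
proof
  assume "span {h} \<subseteq> weight_kernel D l"
  moreover have "h \<in> span {h}" by (simp add: span_base)
  ultimately show "dual_apply (weight D l) h = 0"
    unfolding weight_kernel_def by blast
qed (auto simp: weight_kernel_def span_singleton linear_cmul[OF linear_dual_apply])

lemma block_line_subset_weight_kernel:
  fixes D :: "('b::real_vector, 'v::real_inner) rot_datum"
  assumes "u \<in> plane D l" "q = (wedge2 (inb h) (inV u) :: ('b, 'v) lie ext2)" "q \<noteq> 0"
  shows "block_line D l q \<subseteq> weight_kernel D l \<longleftrightarrow> dual_apply (weight D l) h = 0"
  using assms block_line_eq[OF assms(1), of h] span_singleton_subset_weight_kernel by metis

lemma rank_one_locus_factor:
  fixes D :: "('b::real_vector, 'v::real_inner) rot_datum"
  assumes "rotational_datum D" "p \<in> rank_one_locus D" "l \<in> {1..num_planes D}"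
  obtains h u where "u \<in> plane D l" "block D p l = wedge2 (inb h) (inV u)"
proof -
  have "p \<in> b_wedge_V" and rank: "tensor_rank D l (block D p l) \<le> 1"
    using assms(2,3) by (auto simp: rank_one_locus_def)
  then have "block D p l \<in> b_wedge_plane D l"
    using block_eq[OF assms(1,3)] pr_map_in_b_wedge_plane by metis
  then show ?thesis
    using rank that tensor_rank_le_1_iff by blast
qed

lemma null_locus_iff:
  fixes D :: "('b::real_vector, 'v::real_inner) rot_datum"
  assumes D: "rotational_datum D" and p: "p \<in> rank_one_locus D"
  shows "p \<in> null_locus D \<longleftrightarrow>
    (\<forall>l\<in>{1..num_planes D}. \<forall>h. \<forall>u\<in>plane D l.
       block D p l \<noteq> 0 \<and> block D p l = wedge2 (inb h) (inV u) \<longrightarrow> dual_apply (weight D l) h = 0)"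
    (is "_ \<longleftrightarrow> ?R")
proof
  assume "p \<in> null_locus D"
  then show ?R
    unfolding null_locus_def using block_line_subset_weight_kernel by blast
next
  assume R: ?R
  have "block_line D l (block D p l) \<subseteq> weight_kernel D l"
    if l: "l \<in> {1..num_planes D}" and nz: "block D p l \<noteq> 0" for l
  proof -
    obtain h u where hu: "u \<in> plane D l" "block D p l = wedge2 (inb h) (inV u)"
      using rank_one_locus_factor[OF D p l] .
    then show ?thesis
      using R l nz block_line_subset_weight_kernel[OF hu nz] by blast
  qed
  then show "p \<in> null_locus D"
    using p by (simp add: null_locus_def)
qed

lemma eq_0_of_blocks_eq_0:
  fixes D :: "('b::real_vector, 'v::real_inner) rot_datum"
  assumes D: "rotational_datum D" and p: "p \<in> b_wedge_V"
    and "\<And>l. l \<in> {1..num_planes D} \<Longrightarrow> block D p l = 0"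
  shows "p = 0"
  using sum_pr_map[OF D p] assms(3) block_eq[OF D _ p] by simp

lemma schouten_0: "schouten (bracket D) 0 r = 0"
  by (rule bilinear_lzero[OF bilinear_schouten[OF alternating2_bracket]])

section \<open>Vanishing of all blocks\<close>

lemma null_nonnull_eq_0:
  fixes D :: "('b::real_vector, 'v::real_inner) rot_datum"
  assumes D: "rotational_datum D" and "p \<in> null_locus D" "p \<in> nonnull_locus D"
  shows "p = 0"
proof (rule eq_0_of_blocks_eq_0[OF D])
  show "p \<in> b_wedge_V"
    using assms(2) by (simp add: null_locus_def rank_one_locus_def)
  show "block D p l = 0" if "l \<in> {1..num_planes D}" for l
    using assms(2,3) that unfolding null_locus_def nonnull_locus_def by blast
qed

lemma pr_bV_in_null_locus:
  assumes "rotational_datum D" "pr_bV r \<in> rank_one_locus D" "schouten (bracket D) r r = 0"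
  shows "pr_bV r \<in> null_locus D"
  unfolding null_locus_iff[OF assms(1,2)]
  using weight_eq_0_of_block_factor[OF assms(1) _ assms(3)] by blast

text \<open>
  On a split space with weights \<open>\<lambda>\<^sub>l(h\<^sub>l) \<noteq> 0\<close> the contractions recover all the vectors
  \<open>u\<^sub>l\<close>, since a plane different from \<open>l\<close> is killed by the projection to the plane \<open>l\<close>.
\<close>

lemma split_space_eq_0:
  fixes D :: "('b::real_vector, 'v::real_inner) rot_datum" and h :: "nat \<Rightarrow> 'b"
  assumes D: "rotational_datum D"
    and nonnull: "\<And>l. l \<in> {1..num_planes D} \<Longrightarrow> dual_apply (weight D l) (h l) \<noteq> 0"
    and split: "r \<in> split_space D h" and r: "schouten (bracket D) r r = 0"
  shows "r = 0"
proof -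
  obtain u where u: "\<And>l. l \<in> {1..num_planes D} \<Longrightarrow> u l \<in> plane D l"
    and r_eq: "r = (\<Sum>l\<in>{1..num_planes D}. wedge2 (inb (h l)) (inV (u l)))"
    using split unfolding split_space_def by blast
  have "u l = 0" if l: "l \<in> {1..num_planes D}" for l
  proof -
    have "weight_contraction D l (wedge2 (inb (h k)) (inV (u k)))
        = (if k = l then dual_apply (weight D l) (h l) *\<^sub>R u l else 0)"
      if k: "k \<in> {1..num_planes D}" for k
      using plane_proj[OF D k l u[OF k]]
      by (simp add: weight_contraction_wedge2 linear_0[OF linear_dual_apply])
    then have "weight_contraction D l r = dual_apply (weight D l) (h l) *\<^sub>R u l"
      unfolding r_eq linear_sum[OF linear_weight_contraction] using l by simp
    then show ?thesis
      using weight_contraction_eq_0[OF D l r] nonnull[OF l] by simp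
  qed
  then show ?thesis by (simp add: r_eq in_simps wedge2_simps)
qed

lemma zero_in_split_space: "0 \<in> split_space D h"
  unfolding split_space_def
  by (rule CollectI, rule exI[of _ "\<lambda>_. 0"])
    (simp add: in_simps wedge2_simps plane_def span_zero)

lemma pr_bV_decomposed:
  assumes "p \<in> b_wedge_V" "s \<in> ext2_b" "q \<in> ext2_V" "c \<in> z_wedge_g"
  shows "pr_bV (s + p + q + c) = p"
  unfolding pr_bV_eq by (rule pr_bV_unique[OF assms])

text \<open>
  If \<open>\<bb>\<close> is a line, all first factors in a block are multiples of one generator, so that the
  block collapses to a single wedge.
\<close>

lemma b_wedge_plane_factor_dim_1:
  fixes D :: "('b::real_vector, 'v::real_inner) rot_datum"
  assumes gen: "span {h} = (UNIV :: 'b set)" and q: "q \<in> b_wedge_plane D l"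
  obtains u where "u \<in> plane D l" "q = wedge2 (inb h) (inV u)"
proof -
  have "\<exists>u\<in>plane D l. q = wedge2 (inb h) (inV u)"
    using q unfolding wedge_span_def
  proof (induction rule: span_induct_alt)
    case base
    show ?case
      by (rule bexI[of _ 0]) (simp_all add: in_simps wedge2_simps plane_def span_zero)
  next
    case (step c x y)
    then obtain b v u where x: "x = wedge2 (inb b) (inV v)" "v \<in> plane D l"
      and y: "y = wedge2 (inb h) (inV u)" "u \<in> plane D l" by blast
    obtain a where "b = a *\<^sub>R h"
      using gen by (auto simp: span_singleton)
    then have "c *\<^sub>R x + y = wedge2 (inb h) (inV ((c * a) *\<^sub>R v + u))"
      by (simp add: x y in_simps wedge2_simps)
    moreover have "(c * a) *\<^sub>R v + u \<in> plane D l"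
      using x(2) y(2) unfolding plane_def by (intro span_add span_scale)
    ultimately show ?case by blast
  qed
  then show ?thesis using that by blast
qed

lemma pr_bV_eq_0_dim_1:
  fixes D :: "('b::real_vector, 'v::real_inner) rot_datum"
  assumes D: "rotational_datum D" and dim: "dim (UNIV :: 'b set) = 1"
    and r: "schouten (bracket D) r r = 0"
  shows "pr_bV r = 0"
proof -
  obtain B :: "'b set" where "independent B" "span B = UNIV" "card B = dim (UNIV :: 'b set)"
    using basis_exists[of "UNIV :: 'b set"] by (metis top.extremum_uniqueI)
  then obtain h :: 'b where gen: "span {h} = UNIV"
    using dim card_1_singletonE by metis
  have V: "pr_bV r \<in> b_wedge_V"
    unfolding pr_bV_eq by (rule pr_map_in)
  show ?thesis
  proof (rule eq_0_of_blocks_eq_0[OF D V], rule ccontr)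
    fix l assume l: "l \<in> {1..num_planes D}" and nz: "block D (pr_bV r) l \<noteq> 0"
    have "block D (pr_bV r) l \<in> b_wedge_plane D l"
      unfolding block_eq[OF D l V] by (rule pr_map_in_b_wedge_plane)
    from b_wedge_plane_factor_dim_1[OF gen this]
    obtain u where "u \<in> plane D l" "block D (pr_bV r) l = wedge2 (inb h) (inV u)" .
    from weight_eq_0_of_block_factor[OF D l r this nz]
    have "dual_apply (weight D l) b = 0" for b
      using gen span_singleton_subset_weight_kernel[of h D l] by (auto simp: weight_kernel_def)
    then have "weight D l = 0"
      by (simp add: dual_apply_inject[symmetric] zero_dual.rep_eq fun_eq_iff)
    then show False
      using D l by (simp add: rotational_datum_def)
  qed
qed

theorem theoremC:
  fixes D :: "('b::real_vector, 'v::real_inner) rot_datum"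
  assumes "rotational_datum D"
  shows
    "(\<forall>r :: ('b, 'v) lie ext2.
        pr_bV r \<in> rank_one_locus D \<and> schouten (bracket D) r r = 0 \<longrightarrow>
          pr_bV r \<in> null_locus D \<and>
          (\<forall>l\<in>{1..num_planes D}. \<forall>h. \<forall>u\<in>plane D l.
             block D (pr_bV r) l \<noteq> 0 \<and> block D (pr_bV r) l = wedge2 (inb h) (inV u) \<longrightarrow>
               dual_apply (weight D l) h = 0)) \<and>
     (\<forall>p\<in>rank_one_locus D. p \<in> null_locus D \<longleftrightarrow>
        (\<forall>l\<in>{1..num_planes D}. \<forall>h. \<forall>u\<in>plane D l.
           block D p l \<noteq> 0 \<and> block D p l = wedge2 (inb h) (inV u) \<longrightarrow>
             dual_apply (weight D l) h = 0)) \<and>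
     (\<forall>r :: ('b, 'v) lie ext2.
        schouten (bracket D) r r = 0 \<and> pr_bV r \<in> nonnull_locus D \<longrightarrow> pr_bV r = 0) \<and>
     (\<forall>h :: nat \<Rightarrow> 'b. (\<forall>l\<in>{1..num_planes D}. dual_apply (weight D l) (h l) > 0) \<longrightarrow>
        {r \<in> split_space D h. schouten (bracket D) r r = 0} = {0}) \<and>
     (\<forall>p\<in>rank_one_locus D. \<forall>l\<in>{1..num_planes D}. \<forall>h. \<forall>u\<in>plane D l.
        block D p l \<noteq> 0 \<and> block D p l = wedge2 (inb h) (inV u) \<and>
        dual_apply (weight D l) h \<noteq> 0 \<longrightarrow>
          (\<forall>s\<in>ext2_b. \<forall>q\<in>ext2_V. \<forall>c\<in>z_wedge_g.
             schouten (bracket D) (s + p + q + c) (s + p + q + c) \<noteq> 0)) \<and>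
     (dim (UNIV :: 'b set) = 1 \<longrightarrow>
        (\<forall>r :: ('b, 'v) lie ext2. schouten (bracket D) r r = 0 \<longrightarrow> pr_bV r = 0))"
proof (intro conjI allI ballI impI; (elim conjE)?)
  note D = assms
  fix r :: "('b, 'v) lie ext2"
  assume r: "pr_bV r \<in> rank_one_locus D" "schouten (bracket D) r r = 0"
  show "pr_bV r \<in> null_locus D"
    by (rule pr_bV_in_null_locus[OF D r])
  show "dual_apply (weight D l) h = 0"
    if "l \<in> {1..num_planes D}" "u \<in> plane D l" "block D (pr_bV r) l \<noteq> 0"
      "block D (pr_bV r) l = wedge2 (inb h) (inV u)" for l h u
    by (rule weight_eq_0_of_block_factor[OF D that(1) r(2) that(2,4,3)])
next
  fix p :: "('b, 'v) lie ext2"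
  assume "p \<in> rank_one_locus D"
  then show "p \<in> null_locus D \<longleftrightarrow>
      (\<forall>l\<in>{1..num_planes D}. \<forall>h. \<forall>u\<in>plane D l.
         block D p l \<noteq> 0 \<and> block D p l = wedge2 (inb h) (inV u) \<longrightarrow>
           dual_apply (weight D l) h = 0)"
    by (rule null_locus_iff[OF assms])
next
  fix r :: "('b, 'v) lie ext2"
  assume r: "schouten (bracket D) r r = 0" and nonnull: "pr_bV r \<in> nonnull_locus D"
  then have "pr_bV r \<in> null_locus D"
    by (intro pr_bV_in_null_locus[OF assms]) (simp_all add: nonnull_locus_def)
  then show "pr_bV r = 0"
    using null_nonnull_eq_0[OF assms] nonnull by blast
next
  fix h :: "nat \<Rightarrow> 'b"
  assume pos: "\<forall>l\<in>{1..num_planes D}. dual_apply (weight D l) (h l) > 0"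
  have "dual_apply (weight D l) (h l) \<noteq> 0" if "l \<in> {1..num_planes D}" for l
    using pos that by force
  then show "{r \<in> split_space D h. schouten (bracket D) r r = 0} = {0}"
    using split_space_eq_0[OF assms] zero_in_split_space schouten_0 by blast
next
  fix p l h u and s q c :: "('b, 'v) lie ext2"
  assume p: "p \<in> rank_one_locus D" and l: "l \<in> {1..num_planes D}" and u: "u \<in> plane D l"
    and sqc: "s \<in> ext2_b" "q \<in> ext2_V" "c \<in> z_wedge_g"
    and block: "block D p l \<noteq> 0" "block D p l = wedge2 (inb h) (inV u)"
    and h: "dual_apply (weight D l) h \<noteq> 0"
  have "pr_bV (s + p + q + c) = p"
    using p by (intro pr_bV_decomposed sqc) (simp add: rank_one_locus_def)
  then show "schouten (bracket D) (s + p + q + c) (s + p + q + c) \<noteq> 0"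
    using weight_eq_0_of_block_factor[OF assms l _ u, of "s + p + q + c" h] block h by metis
next
  fix r :: "('b, 'v) lie ext2"
  assume "dim (UNIV :: 'b set) = 1" "schouten (bracket D) r r = 0"
  then show "pr_bV r = 0"
    by (rule pr_bV_eq_0_dim_1[OF assms])
qed

end
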